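(* Every fusion category $\mathcal C$ over $\mathbb R$ that contains a Galois nontrivial object admits a faithful grading by the group $\mathrm{Gal}(\mathbb C/\mathbb R)\cong\mathbb Z/2\mathbb Z$.
   Context: A fusion category over a field $\mathbb K$ is a $\mathbb K$-linear finite semisimple rigid monoidal category (finite-dimensional hom spaces, $\mathbb K$-bilinear tensor product) with simple monoidal unit $\mathbb 1$ and unit constraints $\ell,r$; simple objects are not required to have endomorphism algebra $\mathbb K$. For an object $X$ and $e\in\mathrm{End}(\mathbb 1)$ put $$\lambda_X(e)=\ell_X\circ(e\otimes\mathrm{id}_X)\circ\ell_X^{-1},\qquad \rho_X(e)=r_X\circ(\mathrm{id}_X\otimes e)\circ r_X^{-1}.$$ An object $X$ is Galois trivial if $\lambda_X=\rho_X$ as maps $\mathrm{End}(\mathbb 1)\to\mathrm{End}(X)$, and Galois nontrivial otherwise. A grading of $\mathcal C$ by a finite group $\Gamma$ is a decomposition $\mathcal C\simeq\bigoplus_{\gamma\in\Gamma}\mathcal C_\gamma$ into full abelian subcategories with $\mathcal C_\gamma\otimes\mathcal C_\delta\subset\mathcal C_{\gamma\delta}$; it is faithful if every $\mathcal C_\gamma$ is nonzero. *)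

theory Defs
  imports
    "HOL-Algebra.Bij"
    "HOL-Algebra.QuotRing"
    "HOL-Algebra.Elementary_Groups"
    "Jordan_Normal_Form.VS_Connect"
begin

section \<open>Categories\<close>

record ('o, 'm) cat =
  Obj :: "'o set"
  Arr :: "'m set"
  Dom :: "'m \<Rightarrow> 'o"
  Cod :: "'m \<Rightarrow> 'o"
  Id :: "'o \<Rightarrow> 'm"
  Comp :: "'m \<Rightarrow> 'm \<Rightarrow> 'm"  (infixl \<open>\<cdot>\<index>\<close> 70)

definition Hom :: "('o, 'm, 'z) cat_scheme \<Rightarrow> 'o \<Rightarrow> 'o \<Rightarrow> 'm set" where
  "Hom C X Y = {f \<in> Arr C. Dom C f = X \<and> Cod C f = Y}"

locale category =
  fixes C :: "('o, 'm, 'z) cat_scheme" (structure)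
  assumes Dom_in_Obj: "f \<in> Arr C \<Longrightarrow> Dom C f \<in> Obj C"
    and Cod_in_Obj: "f \<in> Arr C \<Longrightarrow> Cod C f \<in> Obj C"
    and Id_in_Hom: "X \<in> Obj C \<Longrightarrow> Id C X \<in> Hom C X X"
    and Comp_in_Hom: "\<lbrakk>f \<in> Hom C X Y; g \<in> Hom C Y Z\<rbrakk> \<Longrightarrow> g \<cdot> f \<in> Hom C X Z"
    and Comp_Id: "f \<in> Hom C X Y \<Longrightarrow> f \<cdot> Id C X = f"
    and Id_Comp: "f \<in> Hom C X Y \<Longrightarrow> Id C Y \<cdot> f = f"
    and Comp_assoc: "\<lbrakk>f \<in> Hom C W X; g \<in> Hom C X Y; h \<in> Hom C Y Z\<rbrakk>
      \<Longrightarrow> (h \<cdot> g) \<cdot> f = h \<cdot> (g \<cdot> f)"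

definition inverse_arrows :: "('o, 'm, 'z) cat_scheme \<Rightarrow> 'm \<Rightarrow> 'm \<Rightarrow> bool" where
  "inverse_arrows C f g \<longleftrightarrow>
     f \<in> Arr C \<and> g \<in> Hom C (Cod C f) (Dom C f) \<and>
     g \<cdot>\<^bsub>C\<^esub> f = Id C (Dom C f) \<and> f \<cdot>\<^bsub>C\<^esub> g = Id C (Cod C f)"

definition iso_arrow :: "('o, 'm, 'z) cat_scheme \<Rightarrow> 'm \<Rightarrow> bool" where
  "iso_arrow C f \<longleftrightarrow> (\<exists>g. inverse_arrows C f g)"

definition inv_arrow :: "('o, 'm, 'z) cat_scheme \<Rightarrow> 'm \<Rightarrow> 'm" where
  "inv_arrow C f = (THE g. inverse_arrows C f g)"

definition isomorphic_objects :: "('o, 'm, 'z) cat_scheme \<Rightarrow> 'o \<Rightarrow> 'o \<Rightarrow> bool" where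
  "isomorphic_objects C X Y \<longleftrightarrow> (\<exists>f \<in> Hom C X Y. iso_arrow C f)"

definition monic :: "('o, 'm, 'z) cat_scheme \<Rightarrow> 'm \<Rightarrow> bool" where
  "monic C m \<longleftrightarrow> m \<in> Arr C \<and>
     (\<forall>W \<in> Obj C. \<forall>u \<in> Hom C W (Dom C m). \<forall>v \<in> Hom C W (Dom C m).
        m \<cdot>\<^bsub>C\<^esub> u = m \<cdot>\<^bsub>C\<^esub> v \<longrightarrow> u = v)"

definition epic :: "('o, 'm, 'z) cat_scheme \<Rightarrow> 'm \<Rightarrow> bool" where
  "epic C e \<longleftrightarrow> e \<in> Arr C \<and>
     (\<forall>W \<in> Obj C. \<forall>u \<in> Hom C (Cod C e) W. \<forall>v \<in> Hom C (Cod C e) W.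
        u \<cdot>\<^bsub>C\<^esub> e = v \<cdot>\<^bsub>C\<^esub> e \<longrightarrow> u = v)"

definition zero_object :: "('o, 'm, 'z) cat_scheme \<Rightarrow> 'o \<Rightarrow> bool" where
  "zero_object C Z \<longleftrightarrow> Z \<in> Obj C \<and>
     (\<forall>X \<in> Obj C. (\<exists>!f. f \<in> Hom C X Z) \<and> (\<exists>!f. f \<in> Hom C Z X))"

definition full_subcategory ::
  "('o, 'm, 'z) cat_scheme \<Rightarrow> 'o set \<Rightarrow> ('o, 'm, 'z) cat_scheme" where
  "full_subcategory C S =
     C\<lparr>Obj := S, Arr := {f \<in> Arr C. Dom C f \<in> S \<and> Cod C f \<in> S}\<rparr>"


section \<open>Linear and abelian categories\<close>

record ('o, 'm, 'k) linear_cat = "('o, 'm) cat" +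
  AddA :: "'m \<Rightarrow> 'm \<Rightarrow> 'm"
  ZeroA :: "'o \<Rightarrow> 'o \<Rightarrow> 'm"
  ScaleA :: "'k \<Rightarrow> 'm \<Rightarrow> 'm"

text \<open>Module records carry a multiplication and a unit, which the module axioms do not constrain.
  The values below are meaningful only for \<open>X = Y\<close>, where they give the endomorphism algebra.\<close>

definition hom_space ::
  "('o, 'm, 'k, 'z) linear_cat_scheme \<Rightarrow> 'o \<Rightarrow> 'o \<Rightarrow> ('k, 'm) module" where
  "hom_space C X Y =
     \<lparr>carrier = Hom C X Y, mult = Comp C, one = Id C X,
      zero = ZeroA C X Y, add = AddA C, smult = ScaleA C\<rparr>"

locale linear_category = category C + K: field K
  for K :: "('k, 'r) ring_scheme" and C :: "('o, 'm, 'k, 'z) linear_cat_scheme" (structure) +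
  assumes vectorspace_hom:
      "\<lbrakk>X \<in> Obj C; Y \<in> Obj C\<rbrakk> \<Longrightarrow> vectorspace K (hom_space C X Y)"
    and Comp_add_left: "\<lbrakk>f \<in> Hom C X Y; g \<in> Hom C Y Z; g' \<in> Hom C Y Z\<rbrakk>
      \<Longrightarrow> AddA C g g' \<cdot> f = AddA C (g \<cdot> f) (g' \<cdot> f)"
    and Comp_add_right: "\<lbrakk>f \<in> Hom C X Y; f' \<in> Hom C X Y; g \<in> Hom C Y Z\<rbrakk>
      \<Longrightarrow> g \<cdot> AddA C f f' = AddA C (g \<cdot> f) (g \<cdot> f')"
    and Comp_scale_left: "\<lbrakk>a \<in> carrier K; f \<in> Hom C X Y; g \<in> Hom C Y Z\<rbrakk>
      \<Longrightarrow> ScaleA C a g \<cdot> f = ScaleA C a (g \<cdot> f)"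
    and Comp_scale_right: "\<lbrakk>a \<in> carrier K; f \<in> Hom C X Y; g \<in> Hom C Y Z\<rbrakk>
      \<Longrightarrow> g \<cdot> ScaleA C a f = ScaleA C a (g \<cdot> f)"

definition is_direct_sum ::
  "('o, 'm, 'k, 'z) linear_cat_scheme \<Rightarrow> 'i set \<Rightarrow> ('i \<Rightarrow> 'o) \<Rightarrow>
   'o \<Rightarrow> ('i \<Rightarrow> 'm) \<Rightarrow> ('i \<Rightarrow> 'm) \<Rightarrow> bool" where
  "is_direct_sum C I Xs S \<iota> \<pi> \<longleftrightarrow>
     finite I \<and> S \<in> Obj C \<and>
     (\<forall>i \<in> I. Xs i \<in> Obj C \<and> \<iota> i \<in> Hom C (Xs i) S \<and> \<pi> i \<in> Hom C S (Xs i)) \<and>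
     (\<forall>i \<in> I. \<forall>j \<in> I. \<pi> j \<cdot>\<^bsub>C\<^esub> \<iota> i = (if i = j then Id C (Xs i) else ZeroA C (Xs i) (Xs j))) \<and>
     (\<Oplus>\<^bsub>hom_space C S S\<^esub> i \<in> I. \<iota> i \<cdot>\<^bsub>C\<^esub> \<pi> i) = Id C S"

definition is_kernel :: "('o, 'm, 'k, 'z) linear_cat_scheme \<Rightarrow> 'm \<Rightarrow> 'm \<Rightarrow> bool" where
  "is_kernel C k f \<longleftrightarrow>
     f \<in> Arr C \<and> k \<in> Arr C \<and> Cod C k = Dom C f \<and>
     f \<cdot>\<^bsub>C\<^esub> k = ZeroA C (Dom C k) (Cod C f) \<and>
     (\<forall>W \<in> Obj C. \<forall>u \<in> Hom C W (Dom C f). f \<cdot>\<^bsub>C\<^esub> u = ZeroA C W (Cod C f) \<longrightarrow>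
        (\<exists>!v. v \<in> Hom C W (Dom C k) \<and> k \<cdot>\<^bsub>C\<^esub> v = u))"

definition is_cokernel :: "('o, 'm, 'k, 'z) linear_cat_scheme \<Rightarrow> 'm \<Rightarrow> 'm \<Rightarrow> bool" where
  "is_cokernel C q f \<longleftrightarrow>
     f \<in> Arr C \<and> q \<in> Arr C \<and> Dom C q = Cod C f \<and>
     q \<cdot>\<^bsub>C\<^esub> f = ZeroA C (Dom C f) (Cod C q) \<and>
     (\<forall>W \<in> Obj C. \<forall>u \<in> Hom C (Cod C f) W. u \<cdot>\<^bsub>C\<^esub> f = ZeroA C (Dom C f) W \<longrightarrow>
        (\<exists>!v. v \<in> Hom C (Cod C q) W \<and> v \<cdot>\<^bsub>C\<^esub> q = u))"

locale abelian_category = linear_category K C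
  for K :: "('k, 'r) ring_scheme" and C :: "('o, 'm, 'k, 'z) linear_cat_scheme" (structure) +
  assumes ex_zero_object: "\<exists>Z. zero_object C Z"
    and ex_binary_direct_sum: "\<lbrakk>X \<in> Obj C; Y \<in> Obj C\<rbrakk>
      \<Longrightarrow> \<exists>S \<iota> \<pi>. is_direct_sum C (UNIV :: bool set) (\<lambda>b. if b then X else Y) S \<iota> \<pi>"
    and ex_kernel: "f \<in> Arr C \<Longrightarrow> \<exists>k. is_kernel C k f"
    and ex_cokernel: "f \<in> Arr C \<Longrightarrow> \<exists>q. is_cokernel C q f"
    and monic_is_kernel: "monic C m \<Longrightarrow> \<exists>f. is_kernel C m f"
    and epic_is_cokernel: "epic C e \<Longrightarrow> \<exists>f. is_cokernel C e f"

definition simple_object :: "('o, 'm, 'z) cat_scheme \<Rightarrow> 'o \<Rightarrow> bool" where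
  "simple_object C X \<longleftrightarrow> X \<in> Obj C \<and> \<not> zero_object C X \<and>
     (\<forall>m. monic C m \<and> Cod C m = X \<longrightarrow> zero_object C (Dom C m) \<or> iso_arrow C m)"

locale finite_semisimple_category = abelian_category K C
  for K :: "('k, 'r) ring_scheme" and C :: "('o, 'm, 'k, 'z) linear_cat_scheme" (structure) +
  assumes fin_dim_hom:
      "\<lbrakk>X \<in> Obj C; Y \<in> Obj C\<rbrakk> \<Longrightarrow> vectorspace.fin_dim K (hom_space C X Y)"
    and semisimple: "X \<in> Obj C \<Longrightarrow>
      \<exists>(n :: nat) Xs \<iota> \<pi>. (\<forall>i < n. simple_object C (Xs i)) \<and> is_direct_sum C {..<n} Xs X \<iota> \<pi>"
    and finitely_many_simples: "\<exists>T. finite T \<and>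
      (\<forall>X. simple_object C X \<longrightarrow> (\<exists>Y \<in> T. simple_object C Y \<and> isomorphic_objects C X Y))"


section \<open>Fusion categories\<close>

record ('o, 'm, 'k) monoidal_cat = "('o, 'm, 'k) linear_cat" +
  TenO :: "'o \<Rightarrow> 'o \<Rightarrow> 'o"  (infixl \<open>\<boxdot>\<index>\<close> 75)
  TenA :: "'m \<Rightarrow> 'm \<Rightarrow> 'm"  (infixl \<open>\<boxtimes>\<index>\<close> 75)
  UnitO :: 'o
  Assoc :: "'o \<Rightarrow> 'o \<Rightarrow> 'o \<Rightarrow> 'm"
  LUnit :: "'o \<Rightarrow> 'm"
  RUnit :: "'o \<Rightarrow> 'm"

locale monoidal_category = category C
  for C :: "('o, 'm, 'k, 'z) monoidal_cat_scheme" (structure) +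
  assumes UnitO_in_Obj: "UnitO C \<in> Obj C"
    and TenO_in_Obj: "\<lbrakk>X \<in> Obj C; Y \<in> Obj C\<rbrakk> \<Longrightarrow> X \<boxdot> Y \<in> Obj C"
    and TenA_in_Hom: "\<lbrakk>f \<in> Hom C X X'; g \<in> Hom C Y Y'\<rbrakk>
      \<Longrightarrow> f \<boxtimes> g \<in> Hom C (X \<boxdot> Y) (X' \<boxdot> Y')"
    and TenA_Id: "\<lbrakk>X \<in> Obj C; Y \<in> Obj C\<rbrakk> \<Longrightarrow> Id C X \<boxtimes> Id C Y = Id C (X \<boxdot> Y)"
    and TenA_Comp: "\<lbrakk>f \<in> Hom C X X'; f' \<in> Hom C X' X''; g \<in> Hom C Y Y'; g' \<in> Hom C Y' Y''\<rbrakk>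
      \<Longrightarrow> (f' \<cdot> f) \<boxtimes> (g' \<cdot> g) = (f' \<boxtimes> g') \<cdot> (f \<boxtimes> g)"
    and Assoc_in_Hom: "\<lbrakk>X \<in> Obj C; Y \<in> Obj C; Z \<in> Obj C\<rbrakk>
      \<Longrightarrow> Assoc C X Y Z \<in> Hom C ((X \<boxdot> Y) \<boxdot> Z) (X \<boxdot> (Y \<boxdot> Z))"
    and Assoc_iso: "\<lbrakk>X \<in> Obj C; Y \<in> Obj C; Z \<in> Obj C\<rbrakk> \<Longrightarrow> iso_arrow C (Assoc C X Y Z)"
    and Assoc_natural: "\<lbrakk>f \<in> Hom C X X'; g \<in> Hom C Y Y'; h \<in> Hom C Z Z'\<rbrakk>
      \<Longrightarrow> Assoc C X' Y' Z' \<cdot> ((f \<boxtimes> g) \<boxtimes> h) = (f \<boxtimes> (g \<boxtimes> h)) \<cdot> Assoc C X Y Z"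
    and LUnit_in_Hom: "X \<in> Obj C \<Longrightarrow> LUnit C X \<in> Hom C (UnitO C \<boxdot> X) X"
    and LUnit_iso: "X \<in> Obj C \<Longrightarrow> iso_arrow C (LUnit C X)"
    and LUnit_natural: "f \<in> Hom C X Y
      \<Longrightarrow> LUnit C Y \<cdot> (Id C (UnitO C) \<boxtimes> f) = f \<cdot> LUnit C X"
    and RUnit_in_Hom: "X \<in> Obj C \<Longrightarrow> RUnit C X \<in> Hom C (X \<boxdot> UnitO C) X"
    and RUnit_iso: "X \<in> Obj C \<Longrightarrow> iso_arrow C (RUnit C X)"
    and RUnit_natural: "f \<in> Hom C X Y
      \<Longrightarrow> RUnit C Y \<cdot> (f \<boxtimes> Id C (UnitO C)) = f \<cdot> RUnit C X"
    and pentagon: "\<lbrakk>W \<in> Obj C; X \<in> Obj C; Y \<in> Obj C; Z \<in> Obj C\<rbrakk>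
      \<Longrightarrow> Assoc C W X (Y \<boxdot> Z) \<cdot> Assoc C (W \<boxdot> X) Y Z
        = (Id C W \<boxtimes> Assoc C X Y Z) \<cdot> Assoc C W (X \<boxdot> Y) Z \<cdot> (Assoc C W X Y \<boxtimes> Id C Z)"
    and triangle: "\<lbrakk>X \<in> Obj C; Y \<in> Obj C\<rbrakk>
      \<Longrightarrow> (Id C X \<boxtimes> LUnit C Y) \<cdot> Assoc C X (UnitO C) Y = RUnit C X \<boxtimes> Id C Y"

text \<open>\<open>Y\<close> is a left dual of \<open>X\<close> (equivalently, \<open>X\<close> is a right dual of \<open>Y\<close>) with evaluation
  \<open>Y \<otimes> X \<rightarrow> 1\<close> and coevaluation \<open>1 \<rightarrow> X \<otimes> Y\<close>.\<close>

definition is_left_dual ::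
  "('o, 'm, 'k, 'z) monoidal_cat_scheme \<Rightarrow> 'o \<Rightarrow> 'o \<Rightarrow> 'm \<Rightarrow> 'm \<Rightarrow> bool" where
  "is_left_dual C X Y ev coev \<longleftrightarrow>
     X \<in> Obj C \<and> Y \<in> Obj C \<and>
     ev \<in> Hom C (Y \<boxdot>\<^bsub>C\<^esub> X) (UnitO C) \<and> coev \<in> Hom C (UnitO C) (X \<boxdot>\<^bsub>C\<^esub> Y) \<and>
     RUnit C X \<cdot>\<^bsub>C\<^esub> (Id C X \<boxtimes>\<^bsub>C\<^esub> ev) \<cdot>\<^bsub>C\<^esub> Assoc C X Y X \<cdot>\<^bsub>C\<^esub> (coev \<boxtimes>\<^bsub>C\<^esub> Id C X)
       \<cdot>\<^bsub>C\<^esub> inv_arrow C (LUnit C X) = Id C X \<and>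
     LUnit C Y \<cdot>\<^bsub>C\<^esub> (ev \<boxtimes>\<^bsub>C\<^esub> Id C Y) \<cdot>\<^bsub>C\<^esub> inv_arrow C (Assoc C Y X Y) \<cdot>\<^bsub>C\<^esub> (Id C Y \<boxtimes>\<^bsub>C\<^esub> coev)
       \<cdot>\<^bsub>C\<^esub> inv_arrow C (RUnit C Y) = Id C Y"

locale fusion_category = finite_semisimple_category K C + monoidal_category C
  for K :: "('k, 'r) ring_scheme" and C :: "('o, 'm, 'k, 'z) monoidal_cat_scheme" (structure) +
  assumes TenA_add_left: "\<lbrakk>f \<in> Hom C X X'; f' \<in> Hom C X X'; g \<in> Hom C Y Y'\<rbrakk>
      \<Longrightarrow> AddA C f f' \<boxtimes> g = AddA C (f \<boxtimes> g) (f' \<boxtimes> g)"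
    and TenA_add_right: "\<lbrakk>f \<in> Hom C X X'; g \<in> Hom C Y Y'; g' \<in> Hom C Y Y'\<rbrakk>
      \<Longrightarrow> f \<boxtimes> AddA C g g' = AddA C (f \<boxtimes> g) (f \<boxtimes> g')"
    and TenA_scale_left: "\<lbrakk>a \<in> carrier K; f \<in> Hom C X X'; g \<in> Hom C Y Y'\<rbrakk>
      \<Longrightarrow> ScaleA C a f \<boxtimes> g = ScaleA C a (f \<boxtimes> g)"
    and TenA_scale_right: "\<lbrakk>a \<in> carrier K; f \<in> Hom C X X'; g \<in> Hom C Y Y'\<rbrakk>
      \<Longrightarrow> f \<boxtimes> ScaleA C a g = ScaleA C a (f \<boxtimes> g)"
    and ex_left_dual: "X \<in> Obj C \<Longrightarrow> \<exists>Y ev coev. is_left_dual C X Y ev coev"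
    and ex_right_dual: "X \<in> Obj C \<Longrightarrow> \<exists>Y ev coev. is_left_dual C Y X ev coev"
    and simple_unit: "simple_object C (UnitO C)"


section \<open>Galois trivial objects\<close>

definition left_embedding ::
  "('o, 'm, 'k, 'z) monoidal_cat_scheme \<Rightarrow> 'o \<Rightarrow> 'm \<Rightarrow> 'm" where
  "left_embedding C X e =
     LUnit C X \<cdot>\<^bsub>C\<^esub> (e \<boxtimes>\<^bsub>C\<^esub> Id C X) \<cdot>\<^bsub>C\<^esub> inv_arrow C (LUnit C X)"

definition right_embedding ::
  "('o, 'm, 'k, 'z) monoidal_cat_scheme \<Rightarrow> 'o \<Rightarrow> 'm \<Rightarrow> 'm" where
  "right_embedding C X e =
     RUnit C X \<cdot>\<^bsub>C\<^esub> (Id C X \<boxtimes>\<^bsub>C\<^esub> e) \<cdot>\<^bsub>C\<^esub> inv_arrow C (RUnit C X)"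

definition galois_trivial :: "('o, 'm, 'k, 'z) monoidal_cat_scheme \<Rightarrow> 'o \<Rightarrow> bool" where
  "galois_trivial C X \<longleftrightarrow>
     (\<forall>e \<in> Hom C (UnitO C) (UnitO C). left_embedding C X e = right_embedding C X e)"

abbreviation galois_nontrivial :: "('o, 'm, 'k, 'z) monoidal_cat_scheme \<Rightarrow> 'o \<Rightarrow> bool" where
  "galois_nontrivial C X \<equiv> \<not> galois_trivial C X"


section \<open>Gradings\<close>

text \<open>Abelian subcategories are required to have an exact inclusion functor.\<close>

definition full_abelian_subcategory ::
  "('k, 'r) ring_scheme \<Rightarrow> ('o, 'm, 'k, 'z) linear_cat_scheme \<Rightarrow> 'o set \<Rightarrow> bool" where
  "full_abelian_subcategory K C S \<longleftrightarrow>
     S \<subseteq> Obj C \<and>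
     abelian_category K (full_subcategory C S) \<and>
     (\<forall>k f. is_kernel (full_subcategory C S) k f \<longrightarrow> is_kernel C k f) \<and>
     (\<forall>q f. is_cokernel (full_subcategory C S) q f \<longrightarrow> is_cokernel C q f)"

text \<open>For finite \<open>I\<close> the direct sum of the full subcategories on \<open>D i\<close> has as objects the families
  \<open>(X\<^sub>i)\<close> with \<open>X\<^sub>i \<in> D i\<close> and as morphisms the families of morphisms \<open>X\<^sub>i \<rightarrow> Y\<^sub>i\<close>.  The two clauses say
  that the functor from it to \<open>C\<close> which sends \<open>(X\<^sub>i)\<close> to the direct sum of the \<open>X\<^sub>i\<close> is an
  equivalence: essentially surjective and fully faithful.\<close>

definition decomposes_as_direct_sum ::
  "('o, 'm, 'k, 'z) linear_cat_scheme \<Rightarrow> 'i set \<Rightarrow> ('i \<Rightarrow> 'o set) \<Rightarrow> bool" where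
  "decomposes_as_direct_sum C I D \<longleftrightarrow>
     (\<forall>X \<in> Obj C. \<exists>Xs \<iota> \<pi>. (\<forall>i \<in> I. Xs i \<in> D i) \<and> is_direct_sum C I Xs X \<iota> \<pi>) \<and>
     (\<forall>Xs X \<iota> \<pi> Ys Y \<iota>' \<pi>'.
        (\<forall>i \<in> I. Xs i \<in> D i \<and> Ys i \<in> D i) \<and>
        is_direct_sum C I Xs X \<iota> \<pi> \<and> is_direct_sum C I Ys Y \<iota>' \<pi>' \<longrightarrow>
        bij_betw (\<lambda>f. \<Oplus>\<^bsub>hom_space C X Y\<^esub> i \<in> I. \<iota>' i \<cdot>\<^bsub>C\<^esub> f i \<cdot>\<^bsub>C\<^esub> \<pi> i)
          (\<Pi>\<^sub>E i \<in> I. Hom C (Xs i) (Ys i)) (Hom C X Y))"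

definition is_grading ::
  "('k, 'r) ring_scheme \<Rightarrow> ('o, 'm, 'k, 'z) monoidal_cat_scheme \<Rightarrow> ('g, 's) monoid_scheme \<Rightarrow>
   ('g \<Rightarrow> 'o set) \<Rightarrow> bool" where
  "is_grading K C \<Gamma> D \<longleftrightarrow>
     group \<Gamma> \<and> finite (carrier \<Gamma>) \<and>
     (\<forall>\<gamma> \<in> carrier \<Gamma>. full_abelian_subcategory K C (D \<gamma>)) \<and>
     decomposes_as_direct_sum C (carrier \<Gamma>) D \<and>
     (\<forall>\<gamma> \<in> carrier \<Gamma>. \<forall>\<delta> \<in> carrier \<Gamma>. \<forall>X \<in> D \<gamma>. \<forall>Y \<in> D \<delta>. X \<boxdot>\<^bsub>C\<^esub> Y \<in> D (\<gamma> \<otimes>\<^bsub>\<Gamma>\<^esub> \<delta>))"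

definition is_faithful_grading ::
  "('k, 'r) ring_scheme \<Rightarrow> ('o, 'm, 'k, 'z) monoidal_cat_scheme \<Rightarrow> ('g, 's) monoid_scheme \<Rightarrow>
   ('g \<Rightarrow> 'o set) \<Rightarrow> bool" where
  "is_faithful_grading K C \<Gamma> D \<longleftrightarrow>
     is_grading K C \<Gamma> D \<and> (\<forall>\<gamma> \<in> carrier \<Gamma>. \<exists>X \<in> D \<gamma>. \<not> zero_object C X)"


section \<open>Galois groups\<close>

definition galois_group :: "('a, 'r) ring_scheme \<Rightarrow> 'a set \<Rightarrow> ('a \<Rightarrow> 'a) monoid" where
  "galois_group L k =
     BijGroup (carrier L)
       \<lparr>carrier := {\<sigma> \<in> ring_iso L L \<inter> Bij (carrier L). \<forall>x \<in> k. \<sigma> x = x}\<rparr>"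

abbreviation Gal_complex_real :: "(complex \<Rightarrow> complex) monoid" where
  "Gal_complex_real \<equiv> galois_group (class_ring :: complex ring) \<real>"

end

theory Submission
  imports Defs "HOL-Computational_Algebra.Fundamental_Theorem_Algebra"
begin

text \<open>
  By Schur's lemma \<open>End(1)\<close> has no zero divisors, so minimal polynomials of its elements over \<open>\<real>\<close> have
  degree at most two, and an element on which the two embeddings differ yields, after completing
  the square, some \<open>J\<close> with \<open>J\<^sup>2 = -1\<close> and \<open>\<lambda>\<^sub>X(J) \<noteq> \<rho>\<^sub>X(J)\<close>.  The endomorphisms \<open>\<lambda>\<^sub>X(J)\<close> and \<open>\<rho>\<^sub>X(J)\<close> are natural
  in \<open>X\<close>, hence commute, so that \<open>(1 \<mp> \<lambda>\<^sub>X(J) \<rho>\<^sub>X(J))/2\<close> are complementary idempotents.  They split every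
  object into a part with \<open>\<lambda>(J) = \<rho>(J)\<close> and a part with \<open>\<lambda>(J) = -\<rho>(J)\<close>.  By naturality there are no
  nonzero morphisms between the two kinds of objects, and the signs multiply under the tensor
  product because \<open>\<rho>\<^sub>X(J) \<otimes> id = id \<otimes> \<lambda>\<^sub>Y(J)\<close>.
\<close>

section \<open>Calculations in linear categories\<close>

text \<open>The sign between the two actions is a Galois element in disguise: J generates a copy of
  the complex numbers in End(1), and on the component of \<sigma> the left action of J is the right
  action of \<sigma>(J), which is J or -J. Most of the work lies in what a grading demands beyond
  splitting objects. Each component has to be abelian with exact inclusion; this is reduced to
  closure under zero objects, subobjects, quotients and binary direct sums. The direct sum functor
  has to be fully faithful; this is reduced to orthogonality of the components. The other obstacle
  is coherence: the constraints of a product, and the two constraints of the unit object, are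
  related only through the axioms. As the embeddings are conjugations by these constraints, the
  discrepancies are automorphisms, and naturality or commutativity of End(1) absorbs them. For
  faithfulness, the unit object has sign 1, because both embeddings are the identity on End(1), and
  J is chosen so as to separate the embeddings of a given object, which therefore has a nonzero
  summand of sign -1.\<close>

lemma Hom_iff: "f \<in> Hom C X Y \<longleftrightarrow> f \<in> Arr C \<and> Dom C f = X \<and> Cod C f = Y"
  by (auto simp: Hom_def)

context category
begin

lemma Hom_imp_Obj: "f \<in> Hom C X Y \<Longrightarrow> X \<in> Obj C \<and> Y \<in> Obj C"
  using Dom_in_Obj Cod_in_Obj by (auto simp: Hom_iff)

text \<open>The axioms type morphisms by \<open>Hom\<close>, with objects that a rewrite rule would
  have to guess. In terms of \<open>Arr\<close>, \<open>Dom\<close> and \<open>Cod\<close> the side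
  conditions become equations that simplification can settle.\<close>

lemma Comp_arr [simp]:
  assumes "f \<in> Arr C" "g \<in> Arr C" "Cod C f = Dom C g"
  shows "g \<cdot> f \<in> Arr C" "Dom C (g \<cdot> f) = Dom C f" "Cod C (g \<cdot> f) = Cod C g"
  using Comp_in_Hom[of f "Dom C f" "Cod C f" g "Cod C g"] assms by (auto simp: Hom_iff)

lemma Id_arr [simp]:
  assumes "X \<in> Obj C"
  shows "Id C X \<in> Arr C" "Dom C (Id C X) = X" "Cod C (Id C X) = X"
  using Id_in_Hom[OF assms] by (auto simp: Hom_iff)

lemma Comp_Id' [simp]: "\<lbrakk>f \<in> Arr C; Dom C f = X\<rbrakk> \<Longrightarrow> f \<cdot> Id C X = f"
  and Id_Comp' [simp]: "\<lbrakk>f \<in> Arr C; Cod C f = X\<rbrakk> \<Longrightarrow> Id C X \<cdot> f = f"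
  by (auto intro: Comp_Id Id_Comp simp: Hom_iff)

lemma Comp_assoc' [simp]:
  "\<lbrakk>f \<in> Arr C; g \<in> Arr C; h \<in> Arr C; Cod C f = Dom C g; Cod C g = Dom C h\<rbrakk>
    \<Longrightarrow> h \<cdot> g \<cdot> f = h \<cdot> (g \<cdot> f)"
  by (rule Comp_assoc) (auto simp: Hom_iff)

lemma inverse_arrows_unique:
  assumes "inverse_arrows C f g" "inverse_arrows C f g'"
  shows "g = g'"
proof -
  have "g = g \<cdot> (f \<cdot> g')"
    using assms by (auto simp: inverse_arrows_def Hom_iff)
  also have "\<dots> = (g \<cdot> f) \<cdot> g'"
    using assms by (intro Comp_assoc[symmetric]) (auto simp: inverse_arrows_def Hom_iff)
  also have "\<dots> = g'"
    using assms Dom_in_Obj by (auto simp: inverse_arrows_def Hom_iff simp del: Comp_assoc')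
  finally show ?thesis .
qed

lemma inv_arrow_inverse: "iso_arrow C f \<Longrightarrow> inverse_arrows C f (inv_arrow C f)"
  unfolding iso_arrow_def inv_arrow_def
  by (metis inverse_arrows_unique theI)

lemma inv_arrow_simps [simp]:
  assumes "iso_arrow C f"
  shows "inv_arrow C f \<in> Arr C" "Dom C (inv_arrow C f) = Cod C f" "Cod C (inv_arrow C f) = Dom C f"
    "f \<cdot> inv_arrow C f = Id C (Cod C f)" "inv_arrow C f \<cdot> f = Id C (Dom C f)" "f \<in> Arr C"
  using inv_arrow_inverse[OF assms] by (auto simp: inverse_arrows_def Hom_iff)

lemma inv_arrow_cancel [simp]:
  assumes "iso_arrow C f" "g \<in> Arr C"
  shows "Cod C g = Cod C f \<Longrightarrow> f \<cdot> (inv_arrow C f \<cdot> g) = g"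
    and "Cod C g = Dom C f \<Longrightarrow> inv_arrow C f \<cdot> (f \<cdot> g) = g"
  using assms by (simp_all flip: Comp_assoc')

lemma iso_arrowI:
  assumes "f \<in> Hom C X Y" "g \<in> Hom C Y X" "g \<cdot> f = Id C X" "f \<cdot> g = Id C Y"
  shows "iso_arrow C f"
  unfolding iso_arrow_def inverse_arrows_def using assms
  by (intro exI[of _ g]) (auto simp: Hom_iff)

lemma iso_cancel_right:
  assumes "iso_arrow C u" "f \<in> Arr C" "g \<in> Arr C" "Dom C f = Cod C u" "Dom C g = Cod C u"
    and "f \<cdot> u = g \<cdot> u"
  shows "f = g"
proof -
  have "f = (f \<cdot> u) \<cdot> inv_arrow C u" using assms(1-4) by simp
  also have "\<dots> = (g \<cdot> u) \<cdot> inv_arrow C u" by (simp only: assms(6))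
  also have "\<dots> = g" using assms(1,3,5) by simp
  finally show ?thesis .
qed

lemma iso_cancel_left:
  assumes "iso_arrow C u" "f \<in> Arr C" "g \<in> Arr C" "Cod C f = Dom C u" "Cod C g = Dom C u"
    and "u \<cdot> f = u \<cdot> g"
  shows "f = g"
proof -
  have "f = inv_arrow C u \<cdot> (u \<cdot> f)" using assms(1,2,4) by simp
  also have "\<dots> = inv_arrow C u \<cdot> (u \<cdot> g)" by (simp only: assms(6))
  also have "\<dots> = g" using assms(1,3,5) by simp
  finally show ?thesis .
qed

lemma iso_Comp:
  assumes "iso_arrow C f" "iso_arrow C g" "Cod C f = Dom C g"
  shows "iso_arrow C (g \<cdot> f)"
  using assms Dom_in_Obj Cod_in_Obj
  by (intro iso_arrowI[of _ "Dom C f" "Cod C g" "inv_arrow C f \<cdot> inv_arrow C g"])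
    (auto simp: Hom_iff)

lemma iso_inv: "iso_arrow C f \<Longrightarrow> iso_arrow C (inv_arrow C f)"
  using Dom_in_Obj Cod_in_Obj
  by (intro iso_arrowI[of _ "Cod C f" "Dom C f" f]) (auto simp: Hom_iff)

lemma iso_Id: "X \<in> Obj C \<Longrightarrow> iso_arrow C (Id C X)"
  by (intro iso_arrowI[of _ X X "Id C X"]) (auto simp: Hom_iff)

end

section \<open>Zero, sums and scalar multiples of morphisms\<close>

lemma hom_space_simps [simp]:
  "carrier (hom_space C X Y) = Hom C X Y"
  "zero (hom_space C X Y) = ZeroA C X Y"
  "add (hom_space C X Y) = AddA C"
  "module.smult (hom_space C X Y) = ScaleA C"
  by (simp_all add: hom_space_def)

context linear_category
begin

lemma module_hom: "\<lbrakk>X \<in> Obj C; Y \<in> Obj C\<rbrakk> \<Longrightarrow> Module.module K (hom_space C X Y)"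
  using vectorspace_hom by (simp add: vectorspace_def)

lemma Zero_arr [simp]:
  assumes "X \<in> Obj C" "Y \<in> Obj C"
  shows "ZeroA C X Y \<in> Arr C" "Dom C (ZeroA C X Y) = X" "Cod C (ZeroA C X Y) = Y"
proof -
  interpret Module.module K "hom_space C X Y" by (rule module_hom[OF assms])
  show "ZeroA C X Y \<in> Arr C" "Dom C (ZeroA C X Y) = X" "Cod C (ZeroA C X Y) = Y"
    using M.zero_closed by (auto simp: Hom_iff)
qed

lemma Add_arr [simp]:
  assumes "f \<in> Arr C" "g \<in> Arr C" "Dom C g = Dom C f" "Cod C g = Cod C f"
  shows "AddA C f g \<in> Arr C" "Dom C (AddA C f g) = Dom C f" "Cod C (AddA C f g) = Cod C f"
proof -
  interpret Module.module K "hom_space C (Dom C f) (Cod C f)"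
    using assms by (intro module_hom Dom_in_Obj Cod_in_Obj)
  show "AddA C f g \<in> Arr C" "Dom C (AddA C f g) = Dom C f" "Cod C (AddA C f g) = Cod C f"
    using M.a_closed[of f g] assms by (auto simp: Hom_iff)
qed

lemma Scale_arr [simp]:
  assumes "a \<in> carrier K" "f \<in> Arr C"
  shows "ScaleA C a f \<in> Arr C" "Dom C (ScaleA C a f) = Dom C f" "Cod C (ScaleA C a f) = Cod C f"
proof -
  interpret Module.module K "hom_space C (Dom C f) (Cod C f)"
    using assms by (intro module_hom Dom_in_Obj Cod_in_Obj)
  show "ScaleA C a f \<in> Arr C" "Dom C (ScaleA C a f) = Dom C f" "Cod C (ScaleA C a f) = Cod C f"
    using smult_closed[of a f] assms by (auto simp: Hom_iff)
qed

lemma Comp_Add_right [simp]: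
  "\<lbrakk>f \<in> Arr C; f' \<in> Arr C; g \<in> Arr C; Dom C f' = Dom C f; Cod C f = Dom C g; Cod C f' = Dom C g\<rbrakk>
    \<Longrightarrow> g \<cdot> AddA C f f' = AddA C (g \<cdot> f) (g \<cdot> f')"
  by (rule Comp_add_right) (auto simp: Hom_iff)

lemma Comp_Add_left [simp]:
  "\<lbrakk>f \<in> Arr C; g \<in> Arr C; g' \<in> Arr C; Cod C g' = Cod C g; Cod C f = Dom C g; Cod C f = Dom C g'\<rbrakk>
    \<Longrightarrow> AddA C g g' \<cdot> f = AddA C (g \<cdot> f) (g' \<cdot> f)"
  by (rule Comp_add_left) (auto simp: Hom_iff)

lemma Comp_Scale_right [simp]:
  "\<lbrakk>a \<in> carrier K; f \<in> Arr C; g \<in> Arr C; Cod C f = Dom C g\<rbrakk>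
    \<Longrightarrow> g \<cdot> ScaleA C a f = ScaleA C a (g \<cdot> f)"
  by (rule Comp_scale_right) (auto simp: Hom_iff)

lemma Comp_Scale_left [simp]:
  "\<lbrakk>a \<in> carrier K; f \<in> Arr C; g \<in> Arr C; Cod C f = Dom C g\<rbrakk>
    \<Longrightarrow> ScaleA C a g \<cdot> f = ScaleA C a (g \<cdot> f)"
  by (rule Comp_scale_left) (auto simp: Hom_iff)

lemma Scale_zero: "\<lbrakk>f \<in> Arr C\<rbrakk> \<Longrightarrow> ScaleA C \<zero>\<^bsub>K\<^esub> f = ZeroA C (Dom C f) (Cod C f)"
  using Module.module.smult_l_null[OF module_hom[OF Dom_in_Obj Cod_in_Obj], of f f f]
  by (auto simp: Hom_iff)

text \<open>A zero morphism is 0 times itself, and scalars move out of composites, so the composite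
  is 0 times a morphism.\<close>

lemma Comp_Zero_right [simp]:
  assumes "X \<in> Obj C" "g \<in> Arr C" "Dom C g = Y"
  shows "g \<cdot> ZeroA C X Y = ZeroA C X (Cod C g)"
proof -
  have "Y \<in> Obj C" using assms Dom_in_Obj by auto
  thus ?thesis
    using assms Scale_zero[of "ZeroA C X Y"] Scale_zero[of "g \<cdot> ZeroA C X Y"]
      Comp_Scale_right[of "\<zero>\<^bsub>K\<^esub>" "ZeroA C X Y" g] by auto
qed

lemma Comp_Zero_left [simp]:
  assumes "Y \<in> Obj C" "g \<in> Arr C" "Cod C g = X"
  shows "ZeroA C X Y \<cdot> g = ZeroA C (Dom C g) Y"
proof -
  have "X \<in> Obj C" using assms Cod_in_Obj by auto
  thus ?thesis
    using assms Scale_zero[of "ZeroA C X Y"] Scale_zero[of "ZeroA C X Y \<cdot> g"]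
      Comp_Scale_left[of "\<zero>\<^bsub>K\<^esub>" g "ZeroA C X Y"] by auto
qed

lemma Add_Zero [simp]:
  assumes "f \<in> Arr C" "Dom C f = X" "Cod C f = Y"
  shows "AddA C f (ZeroA C X Y) = f" "AddA C (ZeroA C X Y) f = f"
proof -
  interpret Module.module K "hom_space C X Y"
    using assms by (metis module_hom Dom_in_Obj Cod_in_Obj)
  show "AddA C f (ZeroA C X Y) = f" "AddA C (ZeroA C X Y) f = f"
    using M.l_zero[of f] M.r_zero[of f] assms by (auto simp: Hom_iff)
qed

text \<open>Subtraction belongs to a particular hom space, whereas \<open>AddA\<close> and
  \<open>ScaleA\<close> are global operations. The third form lets bilinearity of composition apply
  to differences.\<close>

lemma Hom_diff:
  assumes "f \<in> Hom C X Y" "g \<in> Hom C X Y"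
  shows "f \<ominus>\<^bsub>hom_space C X Y\<^esub> g \<in> Hom C X Y"
    and "f \<ominus>\<^bsub>hom_space C X Y\<^esub> g = ZeroA C X Y \<longleftrightarrow> f = g"
    and "f \<ominus>\<^bsub>hom_space C X Y\<^esub> g = AddA C f (ScaleA C (\<ominus>\<^bsub>K\<^esub> \<one>\<^bsub>K\<^esub>) g)"
proof -
  interpret Module.module K "hom_space C X Y"
    using assms by (metis module_hom Hom_imp_Obj)
  show "f \<ominus>\<^bsub>hom_space C X Y\<^esub> g \<in> Hom C X Y"
    using M.minus_closed[of f g] assms by simp
  show "f \<ominus>\<^bsub>hom_space C X Y\<^esub> g = ZeroA C X Y \<longleftrightarrow> f = g"
    using M.minus_equality[of f "\<ominus>\<^bsub>hom_space C X Y\<^esub> g"] M.minus_minus[of f]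
      M.minus_minus[of g] M.r_neg[of g] M.a_inv_closed[of g] assms
    by (auto simp: a_minus_def M.a_comm)
  show "f \<ominus>\<^bsub>hom_space C X Y\<^esub> g = AddA C f (ScaleA C (\<ominus>\<^bsub>K\<^esub> \<one>\<^bsub>K\<^esub>) g)"
    using smult_l_minus[of "\<one>\<^bsub>K\<^esub>" g] smult_one[of g] assms by (simp add: a_minus_def)
qed

lemma Comp_diff_right:
  assumes "f \<in> Hom C X Y" "f' \<in> Hom C X Y" "g \<in> Hom C Y Z"
  shows "g \<cdot> (f \<ominus>\<^bsub>hom_space C X Y\<^esub> f') = (g \<cdot> f) \<ominus>\<^bsub>hom_space C X Z\<^esub> (g \<cdot> f')"
  using assms by (subst (1 2) Hom_diff(3)) (auto simp: Hom_iff)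

lemma Comp_diff_left:
  assumes "f \<in> Hom C X Y" "g \<in> Hom C Y Z" "g' \<in> Hom C Y Z"
  shows "(g \<ominus>\<^bsub>hom_space C Y Z\<^esub> g') \<cdot> f = (g \<cdot> f) \<ominus>\<^bsub>hom_space C X Z\<^esub> (g' \<cdot> f)"
  using assms by (subst (1 2) Hom_diff(3)) (auto simp: Hom_iff)

lemma Comp_finsum_right:
  assumes "finite I" "g \<in> Hom C Y Z" "\<forall>i\<in>I. f i \<in> Hom C X Y" "X \<in> Obj C"
  shows "g \<cdot> (\<Oplus>\<^bsub>hom_space C X Y\<^esub> i \<in> I. f i) = (\<Oplus>\<^bsub>hom_space C X Z\<^esub> i \<in> I. g \<cdot> f i)"
  using assms
proof (induction I rule: finite_induct)
  have obj: "X \<in> Obj C" "Y \<in> Obj C" "Z \<in> Obj C"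
    using assms Hom_imp_Obj by blast+
  interpret XY: Module.module K "hom_space C X Y" using obj by (rule_tac module_hom)
  interpret XZ: Module.module K "hom_space C X Z" using obj by (rule_tac module_hom)
  {
    case empty
    thus ?case using obj by (simp add: Hom_iff)
  next
    case (insert i I)
    hence "(\<Oplus>\<^bsub>hom_space C X Y\<^esub> i \<in> I. f i) \<in> Hom C X Y"
      using XY.M.finsum_closed[of f I] by auto
    thus ?case
      using insert by (subst XY.M.finsum_insert XZ.M.finsum_insert; auto simp: Hom_iff)+
  }
qed

lemma Comp_finsum_left:
  assumes "finite I" "g \<in> Hom C X Y" "\<forall>i\<in>I. f i \<in> Hom C Y Z" "Z \<in> Obj C"
  shows "(\<Oplus>\<^bsub>hom_space C Y Z\<^esub> i \<in> I. f i) \<cdot> g = (\<Oplus>\<^bsub>hom_space C X Z\<^esub> i \<in> I. f i \<cdot> g)"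
  using assms
proof (induction I rule: finite_induct)
  have obj: "X \<in> Obj C" "Y \<in> Obj C" "Z \<in> Obj C"
    using assms Hom_imp_Obj by blast+
  interpret YZ: Module.module K "hom_space C Y Z" using obj by (rule_tac module_hom)
  interpret XZ: Module.module K "hom_space C X Z" using obj by (rule_tac module_hom)
  {
    case empty
    thus ?case using obj by (simp add: Hom_iff)
  next
    case (insert i I)
    hence "(\<Oplus>\<^bsub>hom_space C Y Z\<^esub> i \<in> I. f i) \<in> Hom C Y Z"
      using YZ.M.finsum_closed[of f I] by auto
    thus ?case
      using insert by (subst YZ.M.finsum_insert XZ.M.finsum_insert; auto simp: Hom_iff)+
  }
qed

text \<open>Linearity turns cancellation into a statement about zero: m u = m v says that m kills u
  - v.\<close>

lemma monicI:
  assumes m: "m \<in> Hom C A X"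
    and zero: "\<And>W u. \<lbrakk>u \<in> Hom C W A; m \<cdot> u = ZeroA C W X\<rbrakk> \<Longrightarrow> u = ZeroA C W A"
  shows "monic C m"
  unfolding monic_def
proof (intro conjI ballI impI)
  show "m \<in> Arr C" using m by (simp add: Hom_iff)
  fix W u v assume *: "u \<in> Hom C W (Dom C m)" "v \<in> Hom C W (Dom C m)" "m \<cdot> u = m \<cdot> v"
  hence uv: "u \<in> Hom C W A" "v \<in> Hom C W A" using m by (auto simp: Hom_iff)
  have "m \<cdot> (u \<ominus>\<^bsub>hom_space C W A\<^esub> v) = ZeroA C W X"
    using Comp_diff_right[OF uv m] Hom_diff(2)[of "m \<cdot> u" W X "m \<cdot> v"] uv m *
    by (simp add: Hom_iff)
  thus "u = v" using zero Hom_diff[OF uv] by blast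
qed

lemma epicI:
  assumes e: "e \<in> Hom C X A"
    and zero: "\<And>W u. \<lbrakk>u \<in> Hom C A W; u \<cdot> e = ZeroA C X W\<rbrakk> \<Longrightarrow> u = ZeroA C A W"
  shows "epic C e"
  unfolding epic_def
proof (intro conjI ballI impI)
  show "e \<in> Arr C" using e by (simp add: Hom_iff)
  fix W u v assume *: "u \<in> Hom C (Cod C e) W" "v \<in> Hom C (Cod C e) W" "u \<cdot> e = v \<cdot> e"
  hence uv: "u \<in> Hom C A W" "v \<in> Hom C A W" using e by (auto simp: Hom_iff)
  have "(u \<ominus>\<^bsub>hom_space C A W\<^esub> v) \<cdot> e = ZeroA C X W"
    using Comp_diff_left[OF e uv] Hom_diff(2)[of "u \<cdot> e" X W "v \<cdot> e"] uv e *
    by (simp add: Hom_iff)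
  thus "u = v" using zero Hom_diff[OF uv] by blast
qed

lemma monicD:
  assumes "monic C m" "m \<in> Hom C A X" "u \<in> Hom C W A" "v \<in> Hom C W A" "m \<cdot> u = m \<cdot> v"
  shows "u = v"
  using assms Hom_imp_Obj[of u W A] by (auto simp: monic_def Hom_iff)

lemma epicD:
  assumes "epic C e" "e \<in> Hom C X A" "u \<in> Hom C A W" "v \<in> Hom C A W" "u \<cdot> e = v \<cdot> e"
  shows "u = v"
  using assms Hom_imp_Obj[of u A W] by (auto simp: epic_def Hom_iff)

text \<open>The morphism k u = k v factors through k both by u and by v, and factorisations through
  a kernel are unique.\<close>

lemma is_kernel_monic: "is_kernel C k f \<Longrightarrow> monic C k"
  unfolding monic_def is_kernel_def
proof (elim conjE, intro conjI ballI impI)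
  fix W u v
  assume k: "f \<in> Arr C" "k \<in> Arr C" "Cod C k = Dom C f" "f \<cdot> k = ZeroA C (Dom C k) (Cod C f)"
    and uni: "\<forall>W\<in>Obj C. \<forall>u\<in>Hom C W (Dom C f). f \<cdot> u = ZeroA C W (Cod C f) \<longrightarrow>
           (\<exists>!v. v \<in> Hom C W (Dom C k) \<and> k \<cdot> v = u)"
    and uv: "W \<in> Obj C" "u \<in> Hom C W (Dom C k)" "v \<in> Hom C W (Dom C k)" "k \<cdot> u = k \<cdot> v"
  have "f \<cdot> (k \<cdot> u) = (f \<cdot> k) \<cdot> u" using k(1-3) uv by (simp add: Hom_iff)
  also have "\<dots> = ZeroA C W (Cod C f)" 
    unfolding k(4) using k(1-3) uv by (simp add: Hom_iff Cod_in_Obj)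
  finally have "\<exists>!v. v \<in> Hom C W (Dom C k) \<and> k \<cdot> v = k \<cdot> u"
    using uni uv k by (auto simp: Hom_iff)
  thus "u = v" using uv by metis
qed

lemma is_cokernel_epic: "is_cokernel C q f \<Longrightarrow> epic C q"
  unfolding epic_def is_cokernel_def
proof (elim conjE, intro conjI ballI impI)
  fix W u v
  assume q: "f \<in> Arr C" "q \<in> Arr C" "Dom C q = Cod C f" "q \<cdot> f = ZeroA C (Dom C f) (Cod C q)"
    and uni: "\<forall>W\<in>Obj C. \<forall>u\<in>Hom C (Cod C f) W. u \<cdot> f = ZeroA C (Dom C f) W \<longrightarrow>
           (\<exists>!v. v \<in> Hom C (Cod C q) W \<and> v \<cdot> q = u)"
    and uv: "W \<in> Obj C" "u \<in> Hom C (Cod C q) W" "v \<in> Hom C (Cod C q) W" "u \<cdot> q = v \<cdot> q"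
  have "(u \<cdot> q) \<cdot> f = u \<cdot> (q \<cdot> f)" using q(1-3) uv(1-3) by (simp add: Hom_iff)
  also have "\<dots> = ZeroA C (Dom C f) W" 
    unfolding q(4) using q(1-3) uv by (simp add: Hom_iff Dom_in_Obj)
  finally have "\<exists>!v. v \<in> Hom C (Cod C q) W \<and> v \<cdot> q = u \<cdot> q"
    using uni uv q by (auto simp: Hom_iff)
  thus "u = v" using uv by metis
qed

lemma is_kernelD:
  assumes "is_kernel C k f" "f \<in> Hom C X Y"
  obtains A where "k \<in> Hom C A X" "f \<cdot> k = ZeroA C A Y"
    "\<And>W u. \<lbrakk>u \<in> Hom C W X; f \<cdot> u = ZeroA C W Y\<rbrakk> \<Longrightarrow> \<exists>v. v \<in> Hom C W A \<and> k \<cdot> v = u"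
proof -
  have eq: "Dom C f = X" "Cod C f = Y" using assms(2) by (simp_all add: Hom_iff)
  have "\<exists>v. v \<in> Hom C W (Dom C k) \<and> k \<cdot> v = u"
    if "u \<in> Hom C W X" "f \<cdot> u = ZeroA C W Y" for W u
    using that assms(1) Hom_imp_Obj[OF that(1)] unfolding is_kernel_def eq by blast
  thus ?thesis
    using assms by (intro that[of "Dom C k"]) (auto simp: is_kernel_def Hom_iff)
qed

lemma is_cokernelD:
  assumes "is_cokernel C q f" "f \<in> Hom C X Y"
  obtains A where "q \<in> Hom C Y A" "q \<cdot> f = ZeroA C X A"
    "\<And>W u. \<lbrakk>u \<in> Hom C Y W; u \<cdot> f = ZeroA C X W\<rbrakk> \<Longrightarrow> \<exists>v. v \<in> Hom C A W \<and> v \<cdot> q = u"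
proof -
  have eq: "Dom C f = X" "Cod C f = Y" using assms(2) by (simp_all add: Hom_iff)
  have "\<exists>v. v \<in> Hom C (Cod C q) W \<and> v \<cdot> q = u"
    if "u \<in> Hom C Y W" "u \<cdot> f = ZeroA C X W" for W u
    using that assms(1) Hom_imp_Obj[OF that(1)] unfolding is_cokernel_def eq by blast
  thus ?thesis
    using assms by (intro that[of "Cod C q"]) (auto simp: is_cokernel_def Hom_iff)
qed

text \<open>Monicity of \<open>k\<close> accounts for uniqueness in the universal property, so only
  existence of factorisations remains to be shown.\<close>

lemma is_kernelI:
  assumes "f \<in> Hom C X Y" "k \<in> Hom C A X" "f \<cdot> k = ZeroA C A Y" "monic C k"
    and "\<And>W u. \<lbrakk>u \<in> Hom C W X; f \<cdot> u = ZeroA C W Y\<rbrakk> \<Longrightarrow> \<exists>v. v \<in> Hom C W A \<and> k \<cdot> v = u"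
  shows "is_kernel C k f"
proof -
  have "\<exists>!v. v \<in> Hom C W A \<and> k \<cdot> v = u"
    if "u \<in> Hom C W X" "f \<cdot> u = ZeroA C W Y" for W u
    using assms(5)[OF that] monicD[OF assms(4,2)] by metis
  moreover have eq: "f \<in> Arr C" "k \<in> Arr C" "Cod C k = X" "Dom C f = X" "Cod C f = Y" "Dom C k = A"
    using assms(1,2) by (simp_all add: Hom_iff)
  ultimately show ?thesis
    using assms(3) unfolding is_kernel_def eq by blast
qed

lemma is_cokernelI:
  assumes "f \<in> Hom C X Y" "q \<in> Hom C Y A" "q \<cdot> f = ZeroA C X A" "epic C q"
    and "\<And>W u. \<lbrakk>u \<in> Hom C Y W; u \<cdot> f = ZeroA C X W\<rbrakk> \<Longrightarrow> \<exists>v. v \<in> Hom C A W \<and> v \<cdot> q = u"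
  shows "is_cokernel C q f"
proof -
  have "\<exists>!v. v \<in> Hom C A W \<and> v \<cdot> q = u"
    if "u \<in> Hom C Y W" "u \<cdot> f = ZeroA C X W" for W u
    using assms(5)[OF that] epicD[OF assms(4,2)] by metis
  moreover have eq: "f \<in> Arr C" "q \<in> Arr C" "Dom C q = Y" "Dom C f = X" "Cod C f = Y" "Cod C q = A"
    using assms(1,2) by (simp_all add: Hom_iff)
  ultimately show ?thesis
    using assms(3) unfolding is_cokernel_def eq by blast
qed

end

section \<open>Full abelian subcategories and direct sums\<close>

context linear_category
begin

text \<open>Since \<open>f\<close> kills \<open>m\<close>, it factors as \<open>g \<cdot> q\<close>,
  so whatever \<open>q\<close> kills is killed by \<open>f\<close>. Inside a subcategory this
  replaces \<open>f\<close>, whose codomain may lie outside, by a quotient of the codomain of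
  \<open>m\<close>.\<close>

lemma kernel_of_cokernel:
  assumes "is_kernel C m f" "is_cokernel C q m"
  shows "is_kernel C m q"
proof -
  have m: "m \<in> Hom C (Dom C m) (Cod C m)" and q: "q \<in> Hom C (Cod C m) (Cod C q)"
    and f: "f \<in> Hom C (Cod C m) (Cod C f)"
    and fm: "f \<cdot> m = ZeroA C (Dom C m) (Cod C f)" and qm: "q \<cdot> m = ZeroA C (Dom C m) (Cod C q)"
    using assms by (auto simp: is_kernel_def is_cokernel_def Hom_iff)
  show ?thesis
  proof (rule is_kernelI[OF q m qm is_kernel_monic[OF assms(1)]])
    fix W u assume u: "u \<in> Hom C W (Cod C m)" "q \<cdot> u = ZeroA C W (Cod C q)"
    obtain g where g: "g \<in> Hom C (Cod C q) (Cod C f)" "g \<cdot> q = f"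
      using is_cokernelD[OF assms(2) m] f fm q by (metis Hom_iff)
    have "f \<cdot> u = g \<cdot> (q \<cdot> u)"
      using g q u(1) by (auto simp: Hom_iff)
    also have "\<dots> = ZeroA C W (Cod C f)"
      unfolding u(2) using g u(1) Hom_imp_Obj[of u] by (auto simp: Hom_iff)
    finally show "\<exists>v. v \<in> Hom C W (Dom C m) \<and> m \<cdot> v = u"
      using is_kernelD[OF assms(1) f] u(1) m by (metis Hom_iff)
  qed
qed

text \<open>Dually, \<open>f\<close> factors as \<open>k \<cdot> g\<close>, so a morphism that kills
  \<open>k\<close> kills \<open>f\<close>. The replacement \<open>k\<close> starts at a subobject of
  the domain of \<open>e\<close>.\<close>

lemma cokernel_of_kernel:
  assumes "is_cokernel C e f" "is_kernel C k e"
  shows "is_cokernel C e k"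
proof -
  have e: "e \<in> Hom C (Dom C e) (Cod C e)" and k: "k \<in> Hom C (Dom C k) (Dom C e)"
    and f: "f \<in> Hom C (Dom C f) (Dom C e)"
    and ef: "e \<cdot> f = ZeroA C (Dom C f) (Cod C e)" and ek: "e \<cdot> k = ZeroA C (Dom C k) (Cod C e)"
    using assms by (auto simp: is_kernel_def is_cokernel_def Hom_iff)
  show ?thesis
  proof (rule is_cokernelI[OF k e ek is_cokernel_epic[OF assms(1)]])
    fix W u assume u: "u \<in> Hom C (Dom C e) W" "u \<cdot> k = ZeroA C (Dom C k) W"
    obtain g where g: "g \<in> Hom C (Dom C f) (Dom C k)" "k \<cdot> g = f"
      using is_kernelD[OF assms(2) e] f ef k by (metis Hom_iff)
    have "u \<cdot> f = (u \<cdot> k) \<cdot> g"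
      using g k u(1) by (auto simp: Hom_iff)
    also have "\<dots> = ZeroA C (Dom C f) W"
      unfolding u(2) using g u(1) Hom_imp_Obj[of u] by (auto simp: Hom_iff)
    finally show "\<exists>v. v \<in> Hom C (Cod C e) W \<and> v \<cdot> e = u"
      using is_cokernelD[OF assms(1) f] u(1) e by (metis Hom_iff)
  qed
qed

lemma Hom_zero_object:
  assumes "zero_object C Z" "f \<in> Hom C X Z"
  shows "f = ZeroA C X Z"
proof -
  have Z: "Z \<in> Obj C" using assms by (simp add: zero_object_def)
  thus ?thesis
    using assms Hom_imp_Obj[OF assms(2)] Zero_arr[of X Z]
    unfolding zero_object_def Hom_iff by metis
qed

lemma Id_eq_Zero_imp_zero_object:
  assumes "X \<in> Obj C" "Id C X = ZeroA C X X"
  shows "zero_object C X"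
proof -
  have "f = ZeroA C Y X" if f: "f \<in> Hom C Y X" for Y f
  proof -
    have "f = Id C X \<cdot> f" using f by (simp add: Id_Comp)
    thus ?thesis using f assms Comp_Zero_left[of X f X] by (simp add: Hom_iff)
  qed
  moreover have "f = ZeroA C X Y" if f: "f \<in> Hom C X Y" for Y f
  proof -
    have "f = f \<cdot> Id C X" using f by (simp add: Comp_Id)
    thus ?thesis using f assms Comp_Zero_right[of X f X] by (simp add: Hom_iff)
  qed
  moreover have "ZeroA C Y X \<in> Hom C Y X" "ZeroA C X Y \<in> Hom C X Y" if "Y \<in> Obj C" for Y
    using that assms by (auto simp: Hom_iff)
  ultimately show ?thesis
    using assms(1) unfolding zero_object_def by blast
qed

section \<open>Morphisms into and out of direct sums\<close>

lemma is_direct_sum_Hom: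
  assumes "is_direct_sum C I Xs X \<iota> \<pi>"
  shows "finite I" "X \<in> Obj C" "i \<in> I \<Longrightarrow> Xs i \<in> Obj C"
    "i \<in> I \<Longrightarrow> \<iota> i \<in> Hom C (Xs i) X" "i \<in> I \<Longrightarrow> \<pi> i \<in> Hom C X (Xs i)"
  using assms by (auto simp: is_direct_sum_def)

text \<open>Write the identity of \<open>X\<close> as the sum of the \<iota>_i \<pi>_i and
  distribute composition over it.\<close>

lemma direct_sum_expand:
  assumes S: "is_direct_sum C I Xs X \<iota> \<pi>"
  shows "f \<in> Hom C X Y \<Longrightarrow> (\<Oplus>\<^bsub>hom_space C X Y\<^esub> i \<in> I. (f \<cdot> \<iota> i) \<cdot> \<pi> i) = f"
    and "f \<in> Hom C Y X \<Longrightarrow> (\<Oplus>\<^bsub>hom_space C Y X\<^esub> i \<in> I. \<iota> i \<cdot> (\<pi> i \<cdot> f)) = f"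
proof -
  note H = is_direct_sum_Hom[OF S]
  interpret XX: Module.module K "hom_space C X X" using H(2) by (rule_tac module_hom)
  have sum: "(\<Oplus>\<^bsub>hom_space C X X\<^esub> i \<in> I. \<iota> i \<cdot> \<pi> i) = Id C X"
    using S by (simp add: is_direct_sum_def)
  have eH: "\<forall>i\<in>I. \<iota> i \<cdot> \<pi> i \<in> Hom C X X"
    using Comp_in_Hom[OF H(5) H(4)] by blast
  {
    assume f: "f \<in> Hom C X Y"
    interpret XY: Module.module K "hom_space C X Y"
      using f Hom_imp_Obj[OF f] by (rule_tac module_hom) auto
    have "f = f \<cdot> (\<Oplus>\<^bsub>hom_space C X X\<^esub> i \<in> I. \<iota> i \<cdot> \<pi> i)"
      using f by (simp add: sum Comp_Id)
    also have "\<dots> = (\<Oplus>\<^bsub>hom_space C X Y\<^esub> i \<in> I. f \<cdot> (\<iota> i \<cdot> \<pi> i))"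
      by (rule Comp_finsum_right[OF H(1) f eH H(2)])
    also have "\<dots> = (\<Oplus>\<^bsub>hom_space C X Y\<^esub> i \<in> I. (f \<cdot> \<iota> i) \<cdot> \<pi> i)"
      using Comp_in_Hom[OF Comp_in_Hom[OF H(5) H(4)] f] Comp_assoc[OF H(5) H(4) f]
      by (intro XY.M.add.finprod_cong') auto
    finally show "(\<Oplus>\<^bsub>hom_space C X Y\<^esub> i \<in> I. (f \<cdot> \<iota> i) \<cdot> \<pi> i) = f" by simp
  next
    assume f: "f \<in> Hom C Y X"
    interpret YX: Module.module K "hom_space C Y X"
      using f Hom_imp_Obj[OF f] by (rule_tac module_hom) auto
    have "f = (\<Oplus>\<^bsub>hom_space C X X\<^esub> i \<in> I. \<iota> i \<cdot> \<pi> i) \<cdot> f"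
      using f by (simp add: sum Id_Comp)
    also have "\<dots> = (\<Oplus>\<^bsub>hom_space C Y X\<^esub> i \<in> I. (\<iota> i \<cdot> \<pi> i) \<cdot> f)"
      by (rule Comp_finsum_left[OF H(1) f eH H(2)])
    also have "\<dots> = (\<Oplus>\<^bsub>hom_space C Y X\<^esub> i \<in> I. \<iota> i \<cdot> (\<pi> i \<cdot> f))"
      using Comp_in_Hom[OF Comp_in_Hom[OF f H(5)] H(4)] Comp_assoc[OF f H(5) H(4)]
      by (intro YX.M.add.finprod_cong') auto
    finally show "(\<Oplus>\<^bsub>hom_space C Y X\<^esub> i \<in> I. \<iota> i \<cdot> (\<pi> i \<cdot> f)) = f" by simp
  }
qed

lemma direct_sum_ext:
  assumes S: "is_direct_sum C I Xs X \<iota> \<pi>"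
  shows "\<lbrakk>f \<in> Hom C X Y; g \<in> Hom C X Y; \<And>i. i \<in> I \<Longrightarrow> f \<cdot> \<iota> i = g \<cdot> \<iota> i\<rbrakk> \<Longrightarrow> f = g"
    and "\<lbrakk>f \<in> Hom C Y X; g \<in> Hom C Y X; \<And>i. i \<in> I \<Longrightarrow> \<pi> i \<cdot> f = \<pi> i \<cdot> g\<rbrakk> \<Longrightarrow> f = g"
proof -
  note H = is_direct_sum_Hom[OF S]
  {
    assume *: "f \<in> Hom C X Y" "g \<in> Hom C X Y" "\<And>i. i \<in> I \<Longrightarrow> f \<cdot> \<iota> i = g \<cdot> \<iota> i"
    interpret XY: Module.module K "hom_space C X Y"
      using * Hom_imp_Obj[OF *(1)] by (rule_tac module_hom) auto
    have "(\<Oplus>\<^bsub>hom_space C X Y\<^esub> i \<in> I. (f \<cdot> \<iota> i) \<cdot> \<pi> i) = (\<Oplus>\<^bsub>hom_space C X Y\<^esub> i \<in> I. (g \<cdot> \<iota> i) \<cdot> \<pi> i)"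
      using Comp_in_Hom[OF H(5) Comp_in_Hom[OF H(4) *(2)]] *(3)
      by (intro XY.M.add.finprod_cong') auto
    thus "f = g" using * direct_sum_expand(1)[OF S] by simp
  next
    assume *: "f \<in> Hom C Y X" "g \<in> Hom C Y X" "\<And>i. i \<in> I \<Longrightarrow> \<pi> i \<cdot> f = \<pi> i \<cdot> g"
    interpret YX: Module.module K "hom_space C Y X"
      using * Hom_imp_Obj[OF *(1)] by (rule_tac module_hom) auto
    have "(\<Oplus>\<^bsub>hom_space C Y X\<^esub> i \<in> I. \<iota> i \<cdot> (\<pi> i \<cdot> f)) = (\<Oplus>\<^bsub>hom_space C Y X\<^esub> i \<in> I. \<iota> i \<cdot> (\<pi> i \<cdot> g))"
      using Comp_in_Hom[OF Comp_in_Hom[OF *(2) H(5)] H(4)] *(3)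
      by (intro YX.M.add.finprod_cong') auto
    thus "f = g" using * direct_sum_expand(2)[OF S] by simp
  }
qed

text \<open>Distributing over the sum leaves the terms f_i \<pi>_i \<iota>_j, and orthogonality of
  the summands kills all but i = j.\<close>

lemma direct_sum_component:
  assumes S: "is_direct_sum C I Xs X \<iota> \<pi>" and j: "j \<in> I" and f: "\<And>i. i \<in> I \<Longrightarrow> f i \<in> Hom C (Xs i) Y"
  shows "(\<Oplus>\<^bsub>hom_space C X Y\<^esub> i \<in> I. f i \<cdot> \<pi> i) \<cdot> \<iota> j = f j"
proof -
  note H = is_direct_sum_Hom[OF S]
  have Y: "Y \<in> Obj C" using Hom_imp_Obj[OF f[OF j]] by simp
  interpret jY: Module.module K "hom_space C (Xs j) Y"
    using Y H(3)[OF j] by (rule_tac module_hom)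
  have orth: "\<pi> i \<cdot> \<iota> j = (if j = i then Id C (Xs j) else ZeroA C (Xs j) (Xs i))" if "i \<in> I" for i
    using S j that by (simp add: is_direct_sum_def)
  have "(\<Oplus>\<^bsub>hom_space C X Y\<^esub> i \<in> I. f i \<cdot> \<pi> i) \<cdot> \<iota> j =
      (\<Oplus>\<^bsub>hom_space C (Xs j) Y\<^esub> i \<in> I. (f i \<cdot> \<pi> i) \<cdot> \<iota> j)"
    using Comp_in_Hom[OF H(5) f] Y by (intro Comp_finsum_left[OF H(1) H(4)[OF j]]) auto
  also have "\<dots> = (\<Oplus>\<^bsub>hom_space C (Xs j) Y\<^esub> i \<in> I. if j = i then f j else ZeroA C (Xs j) Y)"
  proof (rule jY.M.add.finprod_cong')
    fix i assume i: "i \<in> I"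
    have "(f i \<cdot> \<pi> i) \<cdot> \<iota> j = f i \<cdot> (\<pi> i \<cdot> \<iota> j)"
      by (rule Comp_assoc[OF H(4)[OF j] H(5)[OF i] f[OF i]])
    thus "(f i \<cdot> \<pi> i) \<cdot> \<iota> j = (if j = i then f j else ZeroA C (Xs j) Y)"
      using f[OF i] H(3)[OF j] unfolding orth[OF i] by (auto simp: Hom_iff)
  qed (use f Y H(3)[OF j] in \<open>auto simp: Hom_iff\<close>)
  also have "\<dots> = f j"
    using jY.M.add.finprod_singleton[OF j H(1), of "\<lambda>_. f j"] f[OF j] by (simp add: finsum_def cong: if_cong)
  finally show ?thesis .
qed

text \<open>Morphisms between direct sums are matrices with entries \<pi>'_j g \<iota>_i.
  Orthogonality of the classes kills the entries off the diagonal, so families of diagonal entries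
  describe all of \<open>Hom C X Y\<close>.\<close>

lemma decomposes_as_direct_sumI:
  assumes ex: "\<And>X. X \<in> Obj C \<Longrightarrow> \<exists>Xs \<iota> \<pi>. (\<forall>i\<in>I. Xs i \<in> D i) \<and> is_direct_sum C I Xs X \<iota> \<pi>"
    and orth: "\<And>i j X Y f. \<lbrakk>i \<in> I; j \<in> I; i \<noteq> j; X \<in> D i; Y \<in> D j; f \<in> Hom C X Y\<rbrakk> \<Longrightarrow> f = ZeroA C X Y"
  shows "decomposes_as_direct_sum C I D"
  unfolding decomposes_as_direct_sum_def
proof (intro conjI ballI allI impI)
  show "\<exists>Xs \<iota> \<pi>. (\<forall>i\<in>I. Xs i \<in> D i) \<and> is_direct_sum C I Xs X \<iota> \<pi>" if "X \<in> Obj C" for X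
    using ex[OF that] .
  fix Xs X \<iota> \<pi> Ys Y \<iota>' \<pi>'
  assume "(\<forall>i\<in>I. Xs i \<in> D i \<and> Ys i \<in> D i) \<and>
       is_direct_sum C I Xs X \<iota> \<pi> \<and> is_direct_sum C I Ys Y \<iota>' \<pi>'"
  hence D: "\<And>i. i \<in> I \<Longrightarrow> Xs i \<in> D i" "\<And>i. i \<in> I \<Longrightarrow> Ys i \<in> D i"
    and SX: "is_direct_sum C I Xs X \<iota> \<pi>" and SY: "is_direct_sum C I Ys Y \<iota>' \<pi>'"
    by auto
  note HX = is_direct_sum_Hom[OF SX] and HY = is_direct_sum_Hom[OF SY]
  interpret XY: Module.module K "hom_space C X Y"
    using HX(2) HY(2) by (rule_tac module_hom) auto
  define \<Phi> where "\<Phi> = (\<lambda>f. \<Oplus>\<^bsub>hom_space C X Y\<^esub> i \<in> I. \<iota>' i \<cdot> f i \<cdot> \<pi> i)"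
  have inner: "\<iota>' i \<cdot> f i \<in> Hom C (Xs i) Y" if "f \<in> (\<Pi>\<^sub>E i \<in> I. Hom C (Xs i) (Ys i))" "i \<in> I" for f i
    using that by (intro Comp_in_Hom[OF _ HY(4)]) auto
  have \<Phi>_Hom: "\<Phi> f \<in> Hom C X Y" if "f \<in> (\<Pi>\<^sub>E i \<in> I. Hom C (Xs i) (Ys i))" for f
    unfolding \<Phi>_def
    using XY.M.finsum_closed[of "\<lambda>i. \<iota>' i \<cdot> f i \<cdot> \<pi> i" I] Comp_in_Hom[OF HX(5) inner[OF that]]
    by auto
  have \<Phi>_comp: "\<Phi> f \<cdot> \<iota> i = \<iota>' i \<cdot> f i" if "f \<in> (\<Pi>\<^sub>E i \<in> I. Hom C (Xs i) (Ys i))" "i \<in> I" for f i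
    unfolding \<Phi>_def using inner[OF that(1)] that by (intro direct_sum_component[OF SX]) auto
  have retract: "\<pi>' i \<cdot> (\<iota>' i \<cdot> g) = g" if "i \<in> I" "g \<in> Hom C Z (Ys i)" for i g Z
  proof -
    have "\<pi>' i \<cdot> \<iota>' i = Id C (Ys i)" using SY that by (simp add: is_direct_sum_def)
    thus ?thesis
      using Comp_assoc[OF that(2) HY(4,5)[OF that(1)]] that by (simp add: Id_Comp)
  qed
  show "bij_betw (\<lambda>f. \<Oplus>\<^bsub>hom_space C X Y\<^esub> i \<in> I. \<iota>' i \<cdot> f i \<cdot> \<pi> i)
          (\<Pi>\<^sub>E i \<in> I. Hom C (Xs i) (Ys i)) (Hom C X Y)"
    unfolding \<Phi>_def[symmetric]
  \<comment> \<open>The inverse reads off the diagonal entries, restricted to \<open>I\<close>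
    because the domain consists of extensional families.\<close>
  proof (rule bij_betwI[where g = "\<lambda>g. \<lambda>i\<in>I. \<pi>' i \<cdot> (g \<cdot> \<iota> i)"])
    show "\<Phi> \<in> (\<Pi>\<^sub>E i \<in> I. Hom C (Xs i) (Ys i)) \<rightarrow> Hom C X Y"
      using \<Phi>_Hom by blast
    show comps: "(\<lambda>g. \<lambda>i\<in>I. \<pi>' i \<cdot> (g \<cdot> \<iota> i)) \<in> Hom C X Y \<rightarrow> (\<Pi>\<^sub>E i \<in> I. Hom C (Xs i) (Ys i))"
      using Comp_in_Hom[OF Comp_in_Hom[OF HX(4)] HY(5)] by auto
    show "(\<lambda>i\<in>I. \<pi>' i \<cdot> (\<Phi> f \<cdot> \<iota> i)) = f" if f: "f \<in> (\<Pi>\<^sub>E i \<in> I. Hom C (Xs i) (Ys i))" for f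
    proof (rule extensionalityI[of _ I])
      show "(\<lambda>i\<in>I. \<pi>' i \<cdot> (\<Phi> f \<cdot> \<iota> i)) i = f i" if "i \<in> I" for i
        using f that retract[OF that, of "f i"] by (auto simp: \<Phi>_comp)
    qed (use f in \<open>auto simp: PiE_def\<close>)
    fix g assume g: "g \<in> Hom C X Y"
    define f where "f = (\<lambda>i\<in>I. \<pi>' i \<cdot> (g \<cdot> \<iota> i))"
    have f: "f \<in> (\<Pi>\<^sub>E i \<in> I. Hom C (Xs i) (Ys i))"
      using comps g unfolding f_def by blast
    have "\<Phi> f = g"
    proof (rule direct_sum_ext(1)[OF SX \<Phi>_Hom[OF f] g])
      fix i assume i: "i \<in> I"
      have gi: "g \<cdot> \<iota> i \<in> Hom C (Xs i) Y" using Comp_in_Hom[OF HX(4)[OF i] g] .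
      have "\<iota>' i \<cdot> f i = g \<cdot> \<iota> i"
      proof (rule direct_sum_ext(2)[OF SY inner[OF f i] gi])
        fix j assume j: "j \<in> I"
        show "\<pi>' j \<cdot> (\<iota>' i \<cdot> f i) = \<pi>' j \<cdot> (g \<cdot> \<iota> i)"
        proof (cases "i = j")
          case True
          thus ?thesis using retract[OF i, of "f i"] f i by (auto simp: f_def)
        next
          case False
          \<comment> \<open>Both sides are morphisms from an object of \<open>D i\<close> to one of
            \<open>D j\<close> with i \<noteq> j, so both vanish.\<close>
          have "\<pi>' j \<cdot> (\<iota>' i \<cdot> f i) \<in> Hom C (Xs i) (Ys j)" "\<pi>' j \<cdot> (g \<cdot> \<iota> i) \<in> Hom C (Xs i) (Ys j)"
            using Comp_in_Hom[OF inner[OF f i] HY(5)[OF j]] Comp_in_Hom[OF gi HY(5)[OF j]] by auto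
          thus ?thesis
            using orth[OF i j False D(1)[OF i] D(2)[OF j]] by metis
        qed
      qed
      thus "\<Phi> f \<cdot> \<iota> i = g \<cdot> \<iota> i" using \<Phi>_comp[OF f i] by simp
    qed
    thus "\<Phi> (\<lambda>i\<in>I. \<pi>' i \<cdot> (g \<cdot> \<iota> i)) = g" by (simp add: f_def)
  qed
qed

end

section \<open>Splitting idempotents\<close>

context abelian_category
begin

lemma kernelE:
  assumes "f \<in> Hom C X Y"
  obtains A k where "is_kernel C k f" "k \<in> Hom C A X" "f \<cdot> k = ZeroA C A Y" "monic C k"
    "\<And>W u. \<lbrakk>u \<in> Hom C W X; f \<cdot> u = ZeroA C W Y\<rbrakk> \<Longrightarrow> \<exists>v. v \<in> Hom C W A \<and> k \<cdot> v = u"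
proof -
  obtain k where "is_kernel C k f" using ex_kernel[of f] assms by (auto simp: Hom_iff)
  thus ?thesis using is_kernelD[OF _ assms] is_kernel_monic that by metis
qed

lemma cokernelE:
  assumes "f \<in> Hom C X Y"
  obtains A q where "is_cokernel C q f" "q \<in> Hom C Y A" "q \<cdot> f = ZeroA C X A" "epic C q"
    "\<And>W u. \<lbrakk>u \<in> Hom C Y W; u \<cdot> f = ZeroA C X W\<rbrakk> \<Longrightarrow> \<exists>v. v \<in> Hom C A W \<and> v \<cdot> q = u"
proof -
  obtain q where "is_cokernel C q f" using ex_cokernel[of f] assms by (auto simp: Hom_iff)
  thus ?thesis using is_cokernelD[OF _ assms] is_cokernel_epic that by metis
qed

text \<open>The image of p is obtained as the kernel of the complementary q: as q p = 0, the
  idempotent p factors through that kernel, and the factor is the retraction. The labels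
  \<open>a\<close> and \<open>b\<close> are free, so that elements of the Galois group can index the
  summands.\<close>

lemma complementary_idempotents_split:
  assumes pq: "p \<in> Hom C X X" "q \<in> Hom C X X" "p \<cdot> q = ZeroA C X X" "q \<cdot> p = ZeroA C X X"
    "AddA C p q = Id C X" and ab: "a \<noteq> b"
  shows "\<exists>Xs \<iota> \<pi>. is_direct_sum C {a, b} Xs X \<iota> \<pi> \<and> p \<cdot> \<iota> a = \<iota> a \<and> q \<cdot> \<iota> b = \<iota> b"
proof -
  have X: "X \<in> Obj C" using Hom_imp_Obj[OF pq(1)] by simp
  have half: "\<exists>A i r. i \<in> Hom C A X \<and> r \<in> Hom C X A \<and> i \<cdot> r = p \<and> r \<cdot> i = Id C A \<and>
      p \<cdot> i = i \<and> q \<cdot> i = ZeroA C A X"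
    if h: "p \<in> Hom C X X" "q \<in> Hom C X X" "q \<cdot> p = ZeroA C X X" "AddA C p q = Id C X" for p q
  proof -
    obtain i where i: "is_kernel C i q" using ex_kernel[of q] h by (auto simp: Hom_iff)
    obtain A where A: "i \<in> Hom C A X" "q \<cdot> i = ZeroA C A X"
      and fac: "\<And>W u. \<lbrakk>u \<in> Hom C W X; q \<cdot> u = ZeroA C W X\<rbrakk> \<Longrightarrow> \<exists>v. v \<in> Hom C W A \<and> i \<cdot> v = u"
      using is_kernelD[OF i h(2)] by metis
    obtain r where r: "r \<in> Hom C X A" "i \<cdot> r = p" using fac[OF h(1,3)] by blast
    have obj: "A \<in> Obj C" using Hom_imp_Obj[OF A(1)] by simp
    \<comment> \<open>On the kernel of q, the equation p + q = 1 says that p acts as the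
      identity.\<close>
    have "AddA C p q \<cdot> i = AddA C (p \<cdot> i) (q \<cdot> i)" using A(1) h(1,2) by (intro Comp_add_left)
    hence pi: "p \<cdot> i = i" using h A X by (simp add: Hom_iff)
    have "i \<cdot> (r \<cdot> i) = i \<cdot> Id C A"
      using r A(1) pi by (simp add: Comp_Id flip: Comp_assoc[OF A(1) r(1) A(1)])
    hence "r \<cdot> i = Id C A"
      using monicD[OF is_kernel_monic[OF i] A(1), of "r \<cdot> i" A "Id C A"] r A(1) obj
      by (simp add: Hom_iff)
    thus ?thesis using A r pi by blast
  qed
  have qp: "AddA C q p = Id C X"
  proof -
    interpret Module.module K "hom_space C X X" using X by (rule_tac module_hom)
    show ?thesis using M.a_comm[of p q] pq by simp
  qed
  obtain A i r where A: "i \<in> Hom C A X" "r \<in> Hom C X A" "i \<cdot> r = p" "r \<cdot> i = Id C A"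
      "p \<cdot> i = i" "q \<cdot> i = ZeroA C A X"
    using half[OF pq(1,2,4,5)] by metis
  obtain B j s where B: "j \<in> Hom C B X" "s \<in> Hom C X B" "j \<cdot> s = q" "s \<cdot> j = Id C B"
      "q \<cdot> j = j" "p \<cdot> j = ZeroA C B X"
    using half[OF pq(2,1,3) qp] by metis
  have obj: "A \<in> Obj C" "B \<in> Obj C" using Hom_imp_Obj[OF A(1)] Hom_imp_Obj[OF B(1)] by auto
  \<comment> \<open>Inserting s j = 1 in front turns s i into s (j s) i = s (q i), which vanishes;
    the same works for r j.\<close>
  have "s \<cdot> i = (s \<cdot> j) \<cdot> (s \<cdot> i)" using A(1,2) B(1,2) B(4) by (simp add: Hom_iff del: Comp_assoc')
  also have "\<dots> = s \<cdot> ((j \<cdot> s) \<cdot> i)" using A(1,2) B(1,2) by (simp add: Hom_iff)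
  finally have si: "s \<cdot> i = ZeroA C A B" using A B obj by (simp add: Hom_iff)
  have "r \<cdot> j = (r \<cdot> i) \<cdot> (r \<cdot> j)" using A(1,2) B(1,2) A(4) by (simp add: Hom_iff del: Comp_assoc')
  also have "\<dots> = r \<cdot> ((i \<cdot> r) \<cdot> j)" using A(1,2) B(1,2) by (simp add: Hom_iff)
  finally have rj: "r \<cdot> j = ZeroA C B A" using A B obj by (simp add: Hom_iff)
  define Xs \<iota> \<pi> where "Xs = (\<lambda>c. if c = a then A else B)" "\<iota> = (\<lambda>c. if c = a then i else j)"
    "\<pi> = (\<lambda>c. if c = a then r else s)"
  interpret Module.module K "hom_space C X X" using X by (rule_tac module_hom)
  have "(\<Oplus>\<^bsub>hom_space C X X\<^esub> c \<in> {a, b}. \<iota> c \<cdot> \<pi> c) = Id C X"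
    using ab A(3) B(3) pq by (subst M.finsum_insert) (auto simp: Xs_\<iota>_\<pi>_def Hom_iff)
  hence "is_direct_sum C {a, b} Xs X \<iota> \<pi>"
    using ab A B obj X si rj unfolding is_direct_sum_def by (auto simp: Xs_\<iota>_\<pi>_def)
  moreover have "p \<cdot> \<iota> a = \<iota> a" "q \<cdot> \<iota> b = \<iota> b" using A B ab by (auto simp: Xs_\<iota>_\<pi>_def)
  ultimately show ?thesis by blast
qed

end

section \<open>Full subcategories closed under subobjects, quotients and sums\<close>

lemma full_subcategory_simps [simp]:
  "Obj (full_subcategory C S) = S"
  "f \<in> Arr (full_subcategory C S) \<longleftrightarrow> f \<in> Arr C \<and> Dom C f \<in> S \<and> Cod C f \<in> S"
  "Dom (full_subcategory C S) = Dom C"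
  "Cod (full_subcategory C S) = Cod C"
  "Id (full_subcategory C S) = Id C"
  "Comp (full_subcategory C S) = Comp C"
  by (simp_all add: full_subcategory_def)

lemma full_subcategory_linear_simps [simp]:
  "AddA (full_subcategory C S) = AddA C"
  "ZeroA (full_subcategory C S) = ZeroA C"
  "ScaleA (full_subcategory C S) = ScaleA C"
  by (simp_all add: full_subcategory_def)

lemma Hom_full_subcategory:
  "f \<in> Hom (full_subcategory C S) X Y \<longleftrightarrow> f \<in> Hom C X Y \<and> X \<in> S \<and> Y \<in> S"
  by (auto simp: Hom_iff)

lemma hom_space_full_subcategory:
  "\<lbrakk>X \<in> S; Y \<in> S\<rbrakk> \<Longrightarrow> hom_space (full_subcategory C S) X Y = hom_space C X Y"
  by (auto simp: hom_space_def Hom_full_subcategory)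

lemma (in linear_category) linear_category_full_subcategory:
  assumes "S \<subseteq> Obj C"
  shows "linear_category K (full_subcategory C S)"
proof (intro linear_category.intro category.intro linear_category_axioms.intro)
  show "field K" by (rule K.field_axioms)
  show "vectorspace K (hom_space (full_subcategory C S) X Y)"
    if "X \<in> Obj (full_subcategory C S)" "Y \<in> Obj (full_subcategory C S)" for X Y
    using that assms vectorspace_hom by (auto simp: hom_space_full_subcategory)
  show "Id (full_subcategory C S) X \<in> Hom (full_subcategory C S) X X"
    if "X \<in> Obj (full_subcategory C S)" for X
    using that assms by (auto simp: Hom_iff)
qed (auto simp: Hom_iff Hom_full_subcategory)

text \<open>Closure under subobjects and quotients keeps kernels and cokernels formed in
  \<open>C\<close> inside \<open>S\<close>, which is what makes the inclusion exact. Closure under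
  sums concerns every direct sum of the pair, not a chosen one.\<close>

locale closed_subcategory = abelian_category K C
  for K :: "('k, 'r) ring_scheme" and C :: "('o, 'm, 'k, 'z) linear_cat_scheme" (structure) +
  fixes S :: "'o set"
  assumes closed_Obj: "S \<subseteq> Obj C"
    and closed_zero: "zero_object C Z \<Longrightarrow> Z \<in> S"
    and closed_sub: "\<lbrakk>m \<in> Hom C A X; monic C m; X \<in> S\<rbrakk> \<Longrightarrow> A \<in> S"
    and closed_quot: "\<lbrakk>e \<in> Hom C X A; epic C e; X \<in> S\<rbrakk> \<Longrightarrow> A \<in> S"
    and closed_sum: "\<lbrakk>is_direct_sum C (UNIV :: bool set) (\<lambda>b. if b then X else Y) P \<iota> \<pi>; X \<in> S; Y \<in> S\<rbrakk>
      \<Longrightarrow> P \<in> S"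
begin

sublocale sub: linear_category K "full_subcategory C S"
  by (rule linear_category_full_subcategory[OF closed_Obj])

lemma sub_zero_object:
  assumes "zero_object C Z"
  shows "zero_object (full_subcategory C S) Z"
proof -
  have "Z \<in> S" using closed_zero[OF assms] .
  moreover have "(\<exists>!f. f \<in> Hom C X Z) \<and> (\<exists>!f. f \<in> Hom C Z X)" if "X \<in> S" for X
    using assms that closed_Obj unfolding zero_object_def by blast
  ultimately show ?thesis by (simp add: zero_object_def Hom_full_subcategory)
qed

text \<open>A subcategory has fewer test morphisms, so monicity inside it is a priori weaker. But
  the kernel of \<open>m\<close> in \<open>C\<close> is a subobject of \<open>A\<close>, hence lies
  in \<open>S\<close>, and testing against it shows that the kernel morphism is zero.\<close>

lemma sub_monic_iff:
  assumes m: "m \<in> Hom (full_subcategory C S) A X"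
  shows "monic (full_subcategory C S) m \<longleftrightarrow> monic C m"
proof
  assume "monic C m"
  thus "monic (full_subcategory C S) m"
    using closed_Obj m by (auto simp: monic_def Hom_full_subcategory Hom_iff)
next
  assume mono: "monic (full_subcategory C S) m"
  have m': "m \<in> Hom C A X" "A \<in> S" "X \<in> S" using m by (auto simp: Hom_full_subcategory)
  obtain B k where k: "k \<in> Hom C B A" "m \<cdot> k = ZeroA C B X" "monic C k"
    and fac: "\<And>W u. \<lbrakk>u \<in> Hom C W A; m \<cdot> u = ZeroA C W X\<rbrakk> \<Longrightarrow> \<exists>v. v \<in> Hom C W B \<and> k \<cdot> v = u"
    using kernelE[OF m'(1)] by metis
  have B: "B \<in> S" using closed_sub[OF k(1,3) m'(2)] .
  have obj: "B \<in> Obj C" "A \<in> Obj C" using k Hom_imp_Obj by blast+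
  have "k = ZeroA C B A"
    using B obj Zero_arr[OF obj] sub.monicD[OF mono m, of k B "ZeroA C B A"] k m' closed_Obj
    by (auto simp: Hom_full_subcategory Hom_iff)
  note k0 = this
  show "monic C m"
  proof (rule monicI[OF m'(1)])
    fix W u assume "u \<in> Hom C W A" "m \<cdot> u = ZeroA C W X"
    then obtain v where "v \<in> Hom C W B" "k \<cdot> v = u" using fac by blast
    thus "u = ZeroA C W A" using obj k0 by (auto simp: Hom_iff)
  qed
qed

text \<open>Dual argument with the cokernel of \<open>e\<close>, which is a quotient of
  \<open>A\<close> and so lies in \<open>S\<close>.\<close>

lemma sub_epic_iff:
  assumes e: "e \<in> Hom (full_subcategory C S) X A"
  shows "epic (full_subcategory C S) e \<longleftrightarrow> epic C e"
proof
  assume "epic C e"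
  thus "epic (full_subcategory C S) e"
    using closed_Obj e by (auto simp: epic_def Hom_full_subcategory Hom_iff)
next
  assume epi: "epic (full_subcategory C S) e"
  have e': "e \<in> Hom C X A" "A \<in> S" "X \<in> S" using e by (auto simp: Hom_full_subcategory)
  obtain B q where q: "q \<in> Hom C A B" "q \<cdot> e = ZeroA C X B" "epic C q"
    and fac: "\<And>W u. \<lbrakk>u \<in> Hom C A W; u \<cdot> e = ZeroA C X W\<rbrakk> \<Longrightarrow> \<exists>v. v \<in> Hom C B W \<and> v \<cdot> q = u"
    using cokernelE[OF e'(1)] by metis
  have B: "B \<in> S" using closed_quot[OF q(1,3) e'(2)] .
  have obj: "B \<in> Obj C" "A \<in> Obj C" using q Hom_imp_Obj by blast+
  have "q = ZeroA C A B"
    using B obj Zero_arr[OF obj(2,1)] sub.epicD[OF epi e, of q B "ZeroA C A B"] q e' closed_Obj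
    by (auto simp: Hom_full_subcategory Hom_iff)
  note q0 = this
  show "epic C e"
  proof (rule epicI[OF e'(1)])
    fix W u assume "u \<in> Hom C A W" "u \<cdot> e = ZeroA C X W"
    then obtain v where "v \<in> Hom C B W" "v \<cdot> q = u" using fac by blast
    thus "u = ZeroA C A W" using obj q0 by (auto simp: Hom_iff)
  qed
qed

lemma sub_is_kernelI:
  assumes ker: "is_kernel C k f" and f: "f \<in> Hom (full_subcategory C S) X Y"
  shows "is_kernel (full_subcategory C S) k f"
proof -
  have f': "f \<in> Hom C X Y" "X \<in> S" "Y \<in> S" using f by (auto simp: Hom_full_subcategory)
  obtain A where k: "k \<in> Hom C A X" "f \<cdot> k = ZeroA C A Y"
    and fac: "\<And>W u. \<lbrakk>u \<in> Hom C W X; f \<cdot> u = ZeroA C W Y\<rbrakk> \<Longrightarrow> \<exists>v. v \<in> Hom C W A \<and> k \<cdot> v = u"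
    using is_kernelD[OF ker f'(1)] by metis
  have mono: "monic C k" by (rule is_kernel_monic[OF ker])
  have A: "A \<in> S" using closed_sub[OF k(1) mono f'(2)] .
  hence k': "k \<in> Hom (full_subcategory C S) A X" using k f' by (simp add: Hom_full_subcategory)
  show ?thesis
    using sub.is_kernelI[OF f k'] sub_monic_iff[OF k'] mono k(2) fac A
    by (auto simp: Hom_full_subcategory)
qed

lemma sub_is_cokernelI:
  assumes coker: "is_cokernel C q f" and f: "f \<in> Hom (full_subcategory C S) X Y"
  shows "is_cokernel (full_subcategory C S) q f"
proof -
  have f': "f \<in> Hom C X Y" "X \<in> S" "Y \<in> S" using f by (auto simp: Hom_full_subcategory)
  obtain A where q: "q \<in> Hom C Y A" "q \<cdot> f = ZeroA C X A"
    and fac: "\<And>W u. \<lbrakk>u \<in> Hom C Y W; u \<cdot> f = ZeroA C X W\<rbrakk> \<Longrightarrow> \<exists>v. v \<in> Hom C A W \<and> v \<cdot> q = u"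
    using is_cokernelD[OF coker f'(1)] by metis
  have epi: "epic C q" by (rule is_cokernel_epic[OF coker])
  have A: "A \<in> S" using closed_quot[OF q(1) epi f'(3)] .
  hence q': "q \<in> Hom (full_subcategory C S) Y A" using q f' by (simp add: Hom_full_subcategory)
  show ?thesis
    using sub.is_cokernelI[OF f q'] sub_epic_iff[OF q'] epi q(2) fac A
    by (auto simp: Hom_full_subcategory)
qed

text \<open>The kernel \<open>l\<close> computed in \<open>C\<close> is a subobject of
  \<open>X\<close>, so it lies in \<open>S\<close> and factors through \<open>k\<close>. A morphism
  from any object of \<open>C\<close> that is killed by \<open>f\<close> factors through
  \<open>l\<close>, and thereby through \<open>k\<close>.\<close>

lemma sub_is_kernelD:
  assumes ker: "is_kernel (full_subcategory C S) k f"
  shows "is_kernel C k f"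
proof -
  obtain X Y where f: "f \<in> Hom (full_subcategory C S) X Y"
    using ker by (auto simp: is_kernel_def Hom_iff)
  have f': "f \<in> Hom C X Y" "X \<in> S" "Y \<in> S" using f by (auto simp: Hom_full_subcategory)
  obtain A where k: "k \<in> Hom (full_subcategory C S) A X" "f \<cdot> k = ZeroA C A Y"
    and fac: "\<And>W u. \<lbrakk>u \<in> Hom (full_subcategory C S) W X; f \<cdot> u = ZeroA C W Y\<rbrakk>
      \<Longrightarrow> \<exists>v. v \<in> Hom (full_subcategory C S) W A \<and> k \<cdot> v = u"
    using sub.is_kernelD[OF ker f] by auto
  have k': "k \<in> Hom C A X" "A \<in> S" using k by (auto simp: Hom_full_subcategory)
  obtain B l where l: "is_kernel C l f" "l \<in> Hom C B X" "f \<cdot> l = ZeroA C B Y" "monic C l"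
    and fac': "\<And>W u. \<lbrakk>u \<in> Hom C W X; f \<cdot> u = ZeroA C W Y\<rbrakk> \<Longrightarrow> \<exists>v. v \<in> Hom C W B \<and> l \<cdot> v = u"
    using kernelE[OF f'(1)] by metis
  have "B \<in> S" using closed_sub[OF l(2,4) f'(2)] .
  then obtain w where w: "w \<in> Hom C B A" "k \<cdot> w = l"
    using fac[of l B] l f' by (auto simp: Hom_full_subcategory)
  show ?thesis
  proof (rule is_kernelI[OF f'(1) k'(1) k(2)])
    show "monic C k" using sub.is_kernel_monic[OF ker] sub_monic_iff[OF k(1)] by simp
    fix W u assume "u \<in> Hom C W X" "f \<cdot> u = ZeroA C W Y"
    then obtain v where v: "v \<in> Hom C W B" "l \<cdot> v = u" using fac' by metis
    hence "k \<cdot> (w \<cdot> v) = u" using Comp_assoc[OF v(1) w(1) k'(1)] w by simp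
    thus "\<exists>v. v \<in> Hom C W A \<and> k \<cdot> v = u" using Comp_in_Hom[OF v(1) w(1)] by blast
  qed
qed

lemma sub_is_cokernelD:
  assumes coker: "is_cokernel (full_subcategory C S) q f"
  shows "is_cokernel C q f"
proof -
  obtain X Y where f: "f \<in> Hom (full_subcategory C S) X Y"
    using coker by (auto simp: is_cokernel_def Hom_iff)
  have f': "f \<in> Hom C X Y" "X \<in> S" "Y \<in> S" using f by (auto simp: Hom_full_subcategory)
  obtain A where q: "q \<in> Hom (full_subcategory C S) Y A" "q \<cdot> f = ZeroA C X A"
    and fac: "\<And>W u. \<lbrakk>u \<in> Hom (full_subcategory C S) Y W; u \<cdot> f = ZeroA C X W\<rbrakk>
      \<Longrightarrow> \<exists>v. v \<in> Hom (full_subcategory C S) A W \<and> v \<cdot> q = u"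
    using sub.is_cokernelD[OF coker f] by auto
  have q': "q \<in> Hom C Y A" "A \<in> S" using q by (auto simp: Hom_full_subcategory)
  obtain B l where l: "is_cokernel C l f" "l \<in> Hom C Y B" "l \<cdot> f = ZeroA C X B" "epic C l"
    and fac': "\<And>W u. \<lbrakk>u \<in> Hom C Y W; u \<cdot> f = ZeroA C X W\<rbrakk> \<Longrightarrow> \<exists>v. v \<in> Hom C B W \<and> v \<cdot> l = u"
    using cokernelE[OF f'(1)] by metis
  have "B \<in> S" using closed_quot[OF l(2,4) f'(3)] .
  then obtain w where w: "w \<in> Hom C A B" "w \<cdot> q = l"
    using fac[of l B] l f' by (auto simp: Hom_full_subcategory)
  show ?thesis
  proof (rule is_cokernelI[OF f'(1) q'(1) q(2)])
    show "epic C q" using sub.is_cokernel_epic[OF coker] sub_epic_iff[OF q(1)] by simp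
    fix W u assume "u \<in> Hom C Y W" "u \<cdot> f = ZeroA C X W"
    then obtain v where v: "v \<in> Hom C B W" "v \<cdot> l = u" using fac' by metis
    hence "(v \<cdot> w) \<cdot> q = u" using Comp_assoc[OF q'(1) w(1) v(1)] w by simp
    thus "\<exists>v. v \<in> Hom C A W \<and> v \<cdot> q = u" using Comp_in_Hom[OF w(1) v(1)] by blast
  qed
qed

theorem full_abelian_subcategory: "full_abelian_subcategory K C S"
  unfolding full_abelian_subcategory_def
proof (intro conjI allI impI)
  show "abelian_category K (full_subcategory C S)"
  proof
    show "\<exists>Z. zero_object (full_subcategory C S) Z"
      using ex_zero_object sub_zero_object by blast
  next
    fix X Y assume XY: "X \<in> Obj (full_subcategory C S)" "Y \<in> Obj (full_subcategory C S)"
    then obtain P \<iota> \<pi> where P: "is_direct_sum C (UNIV :: bool set) (\<lambda>b. if b then X else Y) P \<iota> \<pi>"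
      using ex_binary_direct_sum[of X Y] closed_Obj by auto
    hence "P \<in> S" using closed_sum[OF P] XY by simp
    hence "is_direct_sum (full_subcategory C S) (UNIV :: bool set) (\<lambda>b. if b then X else Y) P \<iota> \<pi>"
      using P XY by (auto simp: is_direct_sum_def Hom_full_subcategory hom_space_full_subcategory)
    thus "\<exists>P \<iota> \<pi>. is_direct_sum (full_subcategory C S) (UNIV :: bool set) (\<lambda>b. if b then X else Y) P \<iota> \<pi>"
      by blast
  next
    fix f assume "f \<in> Arr (full_subcategory C S)"
    hence f: "f \<in> Hom (full_subcategory C S) (Dom C f) (Cod C f)" "f \<in> Arr C" by (auto simp: Hom_iff)
    show "\<exists>k. is_kernel (full_subcategory C S) k f"
      using sub_is_kernelI[OF _ f(1)] ex_kernel[OF f(2)] by blast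
    show "\<exists>q. is_cokernel (full_subcategory C S) q f"
      using sub_is_cokernelI[OF _ f(1)] ex_cokernel[OF f(2)] by blast
  next
    fix m assume mono: "monic (full_subcategory C S) m"
    hence m: "m \<in> Hom (full_subcategory C S) (Dom C m) (Cod C m)" "m \<in> Arr C" "Cod C m \<in> S"
      by (auto simp: Hom_iff monic_def)
    then obtain f q where f: "is_kernel C m f" and q: "is_cokernel C q m"
      using mono sub_monic_iff[OF m(1)] monic_is_kernel[of m] ex_cokernel[of m] by auto
    \<comment> \<open>The morphism \<open>f\<close> with kernel \<open>m\<close> need not end in
      \<open>S\<close>, but the cokernel \<open>q\<close> does, and \<open>m\<close> is also the
      kernel of \<open>q\<close>.\<close>
    have "q \<in> Hom C (Cod C m) (Cod C q)" using q by (auto simp: is_cokernel_def Hom_iff)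
    hence "q \<in> Hom (full_subcategory C S) (Cod C m) (Cod C q)"
      using m(3) closed_quot[OF _ is_cokernel_epic[OF q]] by (auto simp: Hom_full_subcategory)
    thus "\<exists>f. is_kernel (full_subcategory C S) m f"
      using sub_is_kernelI[OF kernel_of_cokernel[OF f q]] by blast
  next
    fix e assume epi: "epic (full_subcategory C S) e"
    hence e: "e \<in> Hom (full_subcategory C S) (Dom C e) (Cod C e)" "e \<in> Arr C" "Dom C e \<in> S"
      by (auto simp: Hom_iff epic_def)
    then obtain f k where f: "is_cokernel C e f" and k: "is_kernel C k e"
      using epi sub_epic_iff[OF e(1)] epic_is_cokernel[of e] ex_kernel[of e] by auto
    have "k \<in> Hom C (Dom C k) (Dom C e)" using k by (auto simp: is_kernel_def Hom_iff)
    hence "k \<in> Hom (full_subcategory C S) (Dom C k) (Dom C e)"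
      using e(3) closed_sub[OF _ is_kernel_monic[OF k]] by (auto simp: Hom_full_subcategory)
    thus "\<exists>f. is_cokernel (full_subcategory C S) e f"
      using sub_is_cokernelI[OF cokernel_of_kernel[OF f k]] by blast
  qed
qed (use closed_Obj sub_is_kernelD sub_is_cokernelD in auto)

end

section \<open>Schur's lemma and real endomorphism algebras\<close>

context abelian_category
begin

text \<open>Schur's argument for \<open>b\<close>: its kernel is all of \<open>X\<close> or zero. In
  the first case b = 0; in the second \<open>b\<close> is monic, hence invertible by simplicity, and
  cancels from a b = 0.\<close>

lemma simple_endo_no_zero_divisors:
  assumes simp: "simple_object C X" and a: "a \<in> Hom C X Y" and b: "b \<in> Hom C X X"
    and ab: "a \<cdot> b = ZeroA C X Y"
  shows "a = ZeroA C X Y \<or> b = ZeroA C X X"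
proof -
  have X: "X \<in> Obj C" and nz: "\<not> zero_object C X" using simp by (auto simp: simple_object_def)
  have Y: "Y \<in> Obj C" using Hom_imp_Obj[OF a] by simp
  obtain k where k: "is_kernel C k b" using ex_kernel[of b] b by (auto simp: Hom_iff)
  obtain A where A: "k \<in> Hom C A X" "b \<cdot> k = ZeroA C A X"
    and fac: "\<And>W u. \<lbrakk>u \<in> Hom C W X; b \<cdot> u = ZeroA C W X\<rbrakk> \<Longrightarrow> \<exists>v. v \<in> Hom C W A \<and> k \<cdot> v = u"
    using is_kernelD[OF k b] by metis
  have "zero_object C A \<or> iso_arrow C k"
    using simp is_kernel_monic[OF k] A(1) by (auto simp: simple_object_def Hom_iff)
  thus ?thesis
  proof
    assume "iso_arrow C k"
    hence "b = (b \<cdot> k) \<cdot> inv_arrow C k"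
      using A(1) b by (auto simp: Hom_iff)
    also have "\<dots> = ZeroA C X X"
      using A(1) X \<open>iso_arrow C k\<close> unfolding A(2) by (auto simp: Hom_iff)
    finally show ?thesis ..
  next
    assume zero: "zero_object C A"
    have "monic C b"
    proof (rule monicI[OF b])
      fix W u assume "u \<in> Hom C W X" "b \<cdot> u = ZeroA C W X"
      then obtain v where v: "v \<in> Hom C W A" "k \<cdot> v = u" using fac by blast
      hence "v = ZeroA C W A" using Hom_zero_object[OF zero] by blast
      thus "u = ZeroA C W X" using v A(1) Hom_imp_Obj[OF v(1)] by (auto simp: Hom_iff)
    qed
    hence iso: "iso_arrow C b"
      using simp nz b by (auto simp: simple_object_def Hom_iff)
    hence "a = (a \<cdot> b) \<cdot> inv_arrow C b"
      using a b by (auto simp: Hom_iff)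
    also have "\<dots> = ZeroA C X Y"
      using a b X Y iso unfolding ab by (auto simp: Hom_iff)
    finally show ?thesis ..
  qed
qed

end

section \<open>Real polynomials evaluated at an endomorphism by Horner's rule\<close>

definition endo_poly :: "('o, 'm, real, 'z) linear_cat_scheme \<Rightarrow> 'o \<Rightarrow> 'm \<Rightarrow> real poly \<Rightarrow> 'm" where
  "endo_poly C X e p =
     fold_coeffs (\<lambda>a g. AddA C (ScaleA C a (Id C X)) (e \<cdot>\<^bsub>C\<^esub> g)) p (ZeroA C X X)"

text \<open>Carries a division with remainder over the reals to a complex root.\<close>

lemma poly_map_of_real:
  fixes p q :: "real poly" and z :: complex
  shows "poly (map_poly of_real (p + q)) z = poly (map_poly of_real p) z + poly (map_poly of_real q) z"
    and "poly (map_poly of_real (p * q)) z = poly (map_poly of_real p) z * poly (map_poly of_real q) z"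
proof -
  have add: "poly (map_poly of_real (p + q)) z = poly (map_poly of_real p) z + poly (map_poly of_real q) z"
    for p q :: "real poly"
    by (induction p q rule: poly_induct2) (auto simp: map_poly_pCons algebra_simps)
  have smult: "poly (map_poly of_real (smult a p)) z = of_real a * poly (map_poly of_real p) z"
    for a and p :: "real poly"
    by (induction p) (auto simp: map_poly_pCons algebra_simps)
  show "poly (map_poly of_real (p + q)) z = poly (map_poly of_real p) z + poly (map_poly of_real q) z"
    by (rule add)
  show "poly (map_poly of_real (p * q)) z = poly (map_poly of_real p) z * poly (map_poly of_real q) z"
    by (induction p) (auto simp: add smult map_poly_pCons algebra_simps)
qed

locale real_linear_category = linear_category "class_ring :: real ring" C
  for C :: "('o, 'm, real, 'z) linear_cat_scheme" (structure)
begin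

lemma Scale_simps:
  assumes "f \<in> Arr C"
  shows "ScaleA C a (ScaleA C b f) = ScaleA C (a * b) f" "ScaleA C 1 f = f"
    "ScaleA C 0 f = ZeroA C (Dom C f) (Cod C f)"
    "AddA C (ScaleA C a f) (ScaleA C b f) = ScaleA C (a + b) f"
proof -
  interpret Module.module "class_ring :: real ring" "hom_space C (Dom C f) (Cod C f)"
    using assms by (intro module_hom Dom_in_Obj Cod_in_Obj)
  have "f \<in> Hom C (Dom C f) (Cod C f)" using assms by (simp add: Hom_iff)
  thus "ScaleA C a (ScaleA C b f) = ScaleA C (a * b) f" "ScaleA C 1 f = f"
    "ScaleA C 0 f = ZeroA C (Dom C f) (Cod C f)"
    "AddA C (ScaleA C a f) (ScaleA C b f) = ScaleA C (a + b) f"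
    using smult_assoc1[of a b f] smult_one[of f] smult_l_null[of f] smult_l_distr[of a b f] by auto
qed

lemma Add_simps:
  assumes "f \<in> Hom C X Y" "g \<in> Hom C X Y" "h \<in> Hom C X Y"
  shows "AddA C (AddA C f g) h = AddA C f (AddA C g h)"
    "AddA C f g = AddA C g f" "AddA C f (AddA C g h) = AddA C g (AddA C f h)"
    "ScaleA C a (AddA C f g) = AddA C (ScaleA C a f) (ScaleA C a g)"
proof -
  interpret Module.module "class_ring :: real ring" "hom_space C X Y"
    using assms Hom_imp_Obj by (metis module_hom)
  show "AddA C (AddA C f g) h = AddA C f (AddA C g h)"
    "AddA C f g = AddA C g f" "AddA C f (AddA C g h) = AddA C g (AddA C f h)"
    "ScaleA C a (AddA C f g) = AddA C (ScaleA C a f) (ScaleA C a g)"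
    using M.a_assoc[of f g h] M.a_comm[of f g] M.a_lcomm[of f g h] smult_r_distr[of a f g] assms by auto
qed

lemma Add_ac:
  assumes "f \<in> Arr C" "g \<in> Arr C" "Dom C g = Dom C f" "Cod C g = Cod C f"
  shows "AddA C f g = AddA C g f"
    and "\<lbrakk>h \<in> Arr C; Dom C h = Dom C f; Cod C h = Cod C f\<rbrakk> \<Longrightarrow> AddA C (AddA C f g) h = AddA C f (AddA C g h)"
    and "\<lbrakk>h \<in> Arr C; Dom C h = Dom C f; Cod C h = Cod C f\<rbrakk> \<Longrightarrow> AddA C f (AddA C g h) = AddA C g (AddA C f h)"
    and "ScaleA C a (AddA C f g) = AddA C (ScaleA C a f) (ScaleA C a g)"
  using assms Add_simps[of f "Dom C f" "Cod C f" g h] Add_simps[of f "Dom C f" "Cod C f" g g]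
  by (auto simp: Hom_iff)

lemma Scale_span_simps:
  assumes "f \<in> Hom C X Y" "g \<in> Hom C X Y"
  shows "AddA C (AddA C (ScaleA C a f) (ScaleA C b g)) (AddA C (ScaleA C c f) (ScaleA C d g)) =
    AddA C (ScaleA C (a + c) f) (ScaleA C (b + d) g)"
  using assms by (simp add: Add_ac Hom_iff flip: Scale_simps(4))

lemma Scale_zero_right [simp]:
  assumes "X \<in> Obj C" "Y \<in> Obj C"
  shows "ScaleA C a (ZeroA C X Y) = ZeroA C X Y"
  using Scale_simps(1)[of "ZeroA C X Y" a 0] Scale_simps(3)[of "ZeroA C X Y"] assms by simp

lemma Scale_eq_zero:
  assumes "f \<in> Arr C" "ScaleA C a f = ZeroA C (Dom C f) (Cod C f)" "a \<noteq> 0"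
  shows "f = ZeroA C (Dom C f) (Cod C f)"
proof -
  have "f = ScaleA C (inverse a) (ScaleA C a f)" using assms(1,3) by (simp add: Scale_simps)
  thus ?thesis using assms Dom_in_Obj Cod_in_Obj by (metis Scale_zero_right)
qed

lemma endo_poly_0 [simp]: "endo_poly C X e 0 = ZeroA C X X"
  by (simp add: endo_poly_def)

context
  fixes X e
  assumes e: "e \<in> Hom C X X"
begin

lemma endo_obj: "X \<in> Obj C"
  using e Hom_imp_Obj by blast

lemma endo_poly_pCons [simp]:
  "endo_poly C X e (pCons a p) = AddA C (ScaleA C a (Id C X)) (e \<cdot> endo_poly C X e p)"
proof (cases "p = 0 \<and> a = 0")
  \<comment> \<open>\<open>pCons 0 0\<close> is the zero polynomial, whose fold performs no Horner
    step, so here both sides are computed to be zero.\<close>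
  case True
  thus ?thesis using e endo_obj by (auto simp: Scale_simps Hom_iff)
next
  case False
  thus ?thesis by (cases "p = 0") (auto simp: endo_poly_def)
qed

lemma endo_poly_in_Hom: "endo_poly C X e p \<in> Hom C X X"
  using e endo_obj by (induction p) (auto simp: Hom_iff)

lemma endo_poly_arr [simp]:
  "endo_poly C X e p \<in> Arr C" "Dom C (endo_poly C X e p) = X" "Cod C (endo_poly C X e p) = X"
  using endo_poly_in_Hom[of p] by (auto simp: Hom_iff)

lemma endo_poly_smult: "endo_poly C X e (smult a p) = ScaleA C a (endo_poly C X e p)"
  using e endo_obj by (induction p) (auto simp: Scale_simps Add_ac Hom_iff)

lemma endo_poly_add: "endo_poly C X e (p + q) = AddA C (endo_poly C X e p) (endo_poly C X e q)"
proof (induction p q rule: poly_induct2)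
  case (pCons a p b q)
  thus ?case using e endo_obj by (auto simp: Add_ac Hom_iff simp flip: Scale_simps(4))
qed (use endo_obj in auto)

lemma endo_poly_mult: "endo_poly C X e (p * q) = endo_poly C X e p \<cdot> endo_poly C X e q"
  using e endo_obj by (induction p) (auto simp: endo_poly_add endo_poly_smult Hom_iff Scale_simps)

lemma endo_poly_sum:
  "finite I \<Longrightarrow> endo_poly C X e (\<Sum>i\<in>I. p i) = (\<Oplus>\<^bsub>hom_space C X X\<^esub> i \<in> I. endo_poly C X e (p i))"
proof (induction I rule: finite_induct)
  interpret Module.module "class_ring :: real ring" "hom_space C X X"
    using endo_obj by (rule_tac module_hom)
  {
    case empty
    thus ?case by simp
  next
    case (insert i I)
    thus ?case using endo_poly_in_Hom by (simp add: endo_poly_add Pi_def)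
  }
qed

text \<open>Otherwise the powers of \<open>e\<close> would be infinitely many linearly independent
  vectors in a finite-dimensional space.\<close>

lemma ex_annihilating_poly:
  assumes fd: "vectorspace.fin_dim class_ring (hom_space C X X)"
  shows "\<exists>p. p \<noteq> 0 \<and> endo_poly C X e p = ZeroA C X X"
proof (rule ccontr)
  assume none: "\<not> ?thesis"
  interpret V: vectorspace "class_ring :: real ring" "hom_space C X X"
    using endo_obj by (rule_tac vectorspace_hom)
  define g where "g = (\<lambda>i. endo_poly C X e (monom 1 i))"
  \<comment> \<open>Independence concerns sets of vectors, so coinciding powers are excluded
    separately; a coincidence would give the annihilating polynomial x^i - x^j.\<close>
  have "inj g"
  proof (rule injI)
    fix i j assume "g i = g j"
    hence "endo_poly C X e (monom 1 i + smult (-1) (monom 1 j)) = ZeroA C X X"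
      by (simp only: endo_poly_add endo_poly_smult g_def)
        (use Scale_simps(3,4)[of "g j"] Scale_simps(2)[of "g j"] Scale_simps(4)[of "g j" 1 "-1"] in \<open>auto simp: g_def\<close>)
    hence "monom 1 i + smult (-1) (monom 1 j) = (0 :: real poly)" using none by blast
    hence "monom 1 i = (monom 1 j :: real poly)" by simp
    thus "i = j" by (metis degree_monom_eq one_neq_zero)
  qed
  have "V.lin_indpt (range g)"
  proof
    assume "V.lin_dep (range g)"
    then obtain A a v where A: "finite A" "A \<subseteq> range g" "V.lincomb a A = ZeroA C X X" "v \<in> A" "a v \<noteq> 0"
      by (auto simp: V.lin_dep_def)
    \<comment> \<open>The linear relation becomes a polynomial; \<open>inv_into\<close> recovers an
      exponent for each vector.\<close>
    define p where "p = (\<Sum>w\<in>A. smult (a w) (monom 1 (inv_into UNIV g w)))"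
    have gi: "endo_poly C X e (monom 1 (inv_into UNIV g w)) = w" if "w \<in> A" for w
      using that A(2) f_inv_into_f[of w g UNIV] by (auto simp: g_def)
    have "endo_poly C X e p = (\<Oplus>\<^bsub>hom_space C X X\<^esub> w \<in> A. ScaleA C (a w) (endo_poly C X e (monom 1 (inv_into UNIV g w))))"
      unfolding p_def endo_poly_sum[OF A(1)] endo_poly_smult ..
    also have "\<dots> = V.lincomb a A"
      unfolding V.lincomb_def
      by (rule V.M.add.finprod_cong') (use A(2) gi in \<open>auto simp: g_def Hom_iff\<close>)
    finally have "p = 0" using A(3) none by auto
    \<comment> \<open>Distinct vectors have distinct exponents, so nothing cancels and the
      coefficient at the exponent of \<open>v\<close> is \<open>a v\<close>, which is
      nonzero.\<close>
    moreover have "coeff p (inv_into UNIV g v) = (\<Sum>w\<in>A. if w = v then a w else 0)"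
      unfolding p_def coeff_sum
    proof (rule sum.cong)
      fix w assume "w \<in> A"
      hence "inv_into UNIV g w = inv_into UNIV g v \<longleftrightarrow> w = v"
        using A by (metis f_inv_into_f subsetD)
      thus "coeff (smult (a w) (monom 1 (inv_into UNIV g w))) (inv_into UNIV g v) = (if w = v then a w else 0)" by simp
    qed simp
    ultimately show False using A by simp
  qed
  moreover have "range g \<subseteq> Hom C X X"
    using endo_poly_in_Hom by (auto simp: g_def)
  ultimately have "finite (range g)"
    using V.li_le_dim(1)[of "range g"] fd by simp
  thus False using \<open>inj g\<close> finite_imageD by auto
qed

text \<open>A nonzero annihilating polynomial of least degree has a complex root z. The minimal real
  polynomial of z divides it and, in the absence of zero divisors, must itself annihilate
  \<open>e\<close>. Completing the square gives a = -Re z and b = Im z.\<close>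

lemma ex_real_quadratic:
  assumes fd: "vectorspace.fin_dim class_ring (hom_space C X X)"
    and nz: "Id C X \<noteq> ZeroA C X X"
    and dom: "\<And>a b. \<lbrakk>a \<in> Hom C X X; b \<in> Hom C X X; a \<cdot> b = ZeroA C X X\<rbrakk>
      \<Longrightarrow> a = ZeroA C X X \<or> b = ZeroA C X X"
  shows "\<exists>a b. (AddA C e (ScaleA C a (Id C X))) \<cdot> (AddA C e (ScaleA C a (Id C X))) = ScaleA C (-(b^2)) (Id C X)"
proof -
  let ?ev = "endo_poly C X e" and ?z = "ZeroA C X X" and ?i = "Id C X"
  \<comment> \<open>For the quadratic, (x + a)^2 = q - b^2, so q(e) = 0 leaves (e + a)^2 = -b^2. For
    the linear polynomial e + a = 0, and the witness for b is 0.\<close>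
  have quad: ?thesis if "?ev q = ?z" "q = [:a,1:] \<or> q = [:a^2 + b^2, 2*a, 1:]" for a b q
    using that(2)
  proof
    assume q: "q = [:a,1:]"
    have "AddA C e (ScaleA C a ?i) = ?z"
      using that(1) e endo_obj by (auto simp: q Scale_simps Add_ac Hom_iff)
    hence "(AddA C e (ScaleA C a (Id C X))) \<cdot> (AddA C e (ScaleA C a (Id C X))) = ScaleA C (-(0^2)) (Id C X)"
      using endo_obj by (simp add: Scale_simps)
    thus ?thesis by blast
  next
    assume q: "q = [:a^2 + b^2, 2*a, 1:]"
    have "[:a,1:] * [:a,1:] = q + [:-(b^2):]" by (simp add: q power2_eq_square)
    hence "?ev ([:a,1:] * [:a,1:]) = ?ev [:-(b^2):]"
      using that(1) endo_obj by (simp only: endo_poly_add) (use e in \<open>auto simp: Scale_simps Hom_iff\<close>)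
    moreover have "?ev [:a,1:] = AddA C e (ScaleA C a ?i)"
      using e endo_obj by (auto simp: Scale_simps Add_ac Hom_iff)
    moreover have "?ev [:-(b^2):] = ScaleA C (-(b^2)) ?i"
      using e endo_obj by (auto simp: Scale_simps Add_ac Hom_iff)
    ultimately show ?thesis by (simp only: endo_poly_mult) blast
  qed
  define P where "P = (\<lambda>p. p \<noteq> 0 \<and> ?ev p = ?z)"
  define p where "p = arg_min degree P"
  have p: "P p" and min: "\<And>q. P q \<Longrightarrow> degree p \<le> degree q"
    using ex_annihilating_poly[OF fd] arg_min_natI[of P _ degree] arg_min_nat_le[of P _ degree]
    unfolding p_def P_def by blast+
  \<comment> \<open>A nonzero constant cannot annihilate, as the identity is nonzero; hence there is
    a complex root.\<close>
  have "degree p \<noteq> 0"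
  proof
    assume "degree p = 0"
    then obtain c where c: "p = [:c:]" by (metis degree_eq_zeroE)
    hence "ScaleA C c ?i = ?z" "c \<noteq> 0" using p endo_obj e by (auto simp: P_def Hom_iff)
    thus False using Scale_eq_zero[of ?i c] nz endo_obj by simp
  qed
  hence "\<not> constant (poly (map_poly of_real p :: complex poly))"
    by (simp add: constant_degree degree_map_poly)
  then obtain z :: complex where z: "poly (map_poly of_real p) z = 0"
    using fundamental_theorem_of_algebra by blast
  \<comment> \<open>The minimal polynomial of z over the reals: linear for real z, otherwise (x - Re
    z)^2 + (Im z)^2.\<close>
  define q where "q = (if Im z = 0 then [:- Re z, 1:] else [:(- Re z)^2 + (Im z)^2, 2 * (- Re z), 1:])"
  have q0: "q \<noteq> 0" and dq: "degree q = (if Im z = 0 then 1 else 2)" by (auto simp: q_def)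
  have qz: "poly (map_poly of_real q) z = 0"
    by (cases z) (auto simp: q_def map_poly_pCons complex_eq_iff power2_eq_square)
  define s where "s = p mod q"
  have ps: "p = q * (p div q) + s" by (simp add: s_def)
  have sz: "poly (map_poly of_real s) z = 0"
    using arg_cong[OF ps, of "\<lambda>p. poly (map_poly of_real p) z"] z qz
    by (simp add: poly_map_of_real)
  \<comment> \<open>The remainder vanishes at z and has smaller degree than \<open>q\<close>. For
    real z it is constant; otherwise it is at most linear, and the imaginary part of its value at z
    forces the slope to be zero.\<close>
  have "s = 0"
  proof (rule ccontr)
    assume "s \<noteq> 0"
    hence ds: "degree s < degree q" using degree_mod_less'[OF q0, of p] by (simp add: s_def)
    hence "degree s \<le> 1" using dq by (auto split: if_splits)
    then obtain a b where s: "s = [:a,b:]"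
      by (metis degree0_coeffs degree1_coeffs le_eq_less_or_eq less_one pCons_0_0)
    have "of_real a + z * of_real b = 0" using sz by (simp add: s map_poly_pCons)
    hence "a + Re z * b = 0" "Im z * b = 0" by (auto simp: complex_eq_iff)
    moreover have "b = 0" if "Im z = 0" using ds dq that by (auto simp: s split: if_splits)
    ultimately show False using \<open>s \<noteq> 0\<close> s by (cases "b = 0") auto
  qed
  hence "?ev (q * (p div q)) = ?z" using p ps by (simp add: P_def)
  hence "?ev q = ?z \<or> ?ev (p div q) = ?z"
    unfolding endo_poly_mult by (intro dom endo_poly_in_Hom)
  \<comment> \<open>The cofactor has smaller degree than \<open>p\<close>, so minimality of
    \<open>p\<close> prevents it from annihilating \<open>e\<close>.\<close>
  moreover have "?ev (p div q) \<noteq> ?z"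
  proof
    assume "?ev (p div q) = ?z"
    moreover have "p div q \<noteq> 0" using ps \<open>s = 0\<close> p by (auto simp: P_def)
    ultimately have "degree p \<le> degree (p div q)" using min by (simp add: P_def)
    moreover have "degree p = degree q + degree (p div q)"
      using ps \<open>s = 0\<close> degree_mult_eq[OF q0 \<open>p div q \<noteq> 0\<close>] by simp
    ultimately show False using dq by (auto split: if_splits)
  qed
  ultimately show ?thesis using quad[of q "- Re z" "Im z"] by (auto simp: q_def split: if_splits)
qed

end

end

section \<open>The two actions of the unit endomorphisms\<close>

context monoidal_category
begin

lemma Ten_simps [simp]:
  assumes "f \<in> Arr C" "g \<in> Arr C"
  shows "f \<boxtimes> g \<in> Arr C" "Dom C (f \<boxtimes> g) = Dom C f \<boxdot> Dom C g" "Cod C (f \<boxtimes> g) = Cod C f \<boxdot> Cod C g"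
  using TenA_in_Hom[of f "Dom C f" "Cod C f" g "Dom C g" "Cod C g"] assms by (auto simp: Hom_iff)

lemma structure_arr [simp]:
  "UnitO C \<in> Obj C"
  "\<lbrakk>X \<in> Obj C; Y \<in> Obj C\<rbrakk> \<Longrightarrow> X \<boxdot> Y \<in> Obj C"
  "X \<in> Obj C \<Longrightarrow> iso_arrow C (LUnit C X)" "X \<in> Obj C \<Longrightarrow> LUnit C X \<in> Arr C"
  "X \<in> Obj C \<Longrightarrow> Dom C (LUnit C X) = UnitO C \<boxdot> X" "X \<in> Obj C \<Longrightarrow> Cod C (LUnit C X) = X"
  "X \<in> Obj C \<Longrightarrow> iso_arrow C (RUnit C X)" "X \<in> Obj C \<Longrightarrow> RUnit C X \<in> Arr C"
  "X \<in> Obj C \<Longrightarrow> Dom C (RUnit C X) = X \<boxdot> UnitO C" "X \<in> Obj C \<Longrightarrow> Cod C (RUnit C X) = X"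
  "\<lbrakk>X \<in> Obj C; Y \<in> Obj C; Z \<in> Obj C\<rbrakk> \<Longrightarrow> iso_arrow C (Assoc C X Y Z)"
  "\<lbrakk>X \<in> Obj C; Y \<in> Obj C; Z \<in> Obj C\<rbrakk> \<Longrightarrow> Assoc C X Y Z \<in> Arr C"
  "\<lbrakk>X \<in> Obj C; Y \<in> Obj C; Z \<in> Obj C\<rbrakk> \<Longrightarrow> Dom C (Assoc C X Y Z) = (X \<boxdot> Y) \<boxdot> Z"
  "\<lbrakk>X \<in> Obj C; Y \<in> Obj C; Z \<in> Obj C\<rbrakk> \<Longrightarrow> Cod C (Assoc C X Y Z) = X \<boxdot> (Y \<boxdot> Z)"
  using UnitO_in_Obj TenO_in_Obj LUnit_iso LUnit_in_Hom RUnit_iso RUnit_in_Hom Assoc_iso Assoc_in_Hom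
  by (auto simp: Hom_iff)

lemma Ten_Comp:
  "\<lbrakk>f \<in> Arr C; f' \<in> Arr C; g \<in> Arr C; g' \<in> Arr C; Cod C f = Dom C f'; Cod C g = Dom C g'\<rbrakk>
    \<Longrightarrow> (f' \<boxtimes> g') \<cdot> (f \<boxtimes> g) = (f' \<cdot> f) \<boxtimes> (g' \<cdot> g)"
  by (rule TenA_Comp[symmetric]) (auto simp: Hom_iff)

lemma iso_Ten:
  assumes "iso_arrow C f" "iso_arrow C g"
  shows "iso_arrow C (f \<boxtimes> g)"
  using assms Dom_in_Obj Cod_in_Obj
  by (intro iso_arrowI[of _ "Dom C f \<boxdot> Dom C g" "Cod C f \<boxdot> Cod C g" "inv_arrow C f \<boxtimes> inv_arrow C g"])
    (auto simp: Hom_iff Ten_Comp TenA_Id)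

section \<open>Typing, naturality and multiplicativity of the two embeddings\<close>

abbreviation unit_End where "unit_End \<equiv> Hom C (UnitO C) (UnitO C)"

lemma left_embedding_arr [simp]:
  assumes "X \<in> Obj C" "e \<in> unit_End"
  shows "left_embedding C X e \<in> Arr C" "Dom C (left_embedding C X e) = X" "Cod C (left_embedding C X e) = X"
  using assms by (auto simp: left_embedding_def Hom_iff)

lemma right_embedding_arr [simp]:
  assumes "X \<in> Obj C" "e \<in> unit_End"
  shows "right_embedding C X e \<in> Arr C" "Dom C (right_embedding C X e) = X" "Cod C (right_embedding C X e) = X"
  using assms by (auto simp: right_embedding_def Hom_iff)

lemma left_embedding_LUnit:
  assumes "X \<in> Obj C" "e \<in> unit_End"
  shows "left_embedding C X e \<cdot> LUnit C X = LUnit C X \<cdot> (e \<boxtimes> Id C X)"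
  using assms by (auto simp: left_embedding_def Hom_iff)

lemma right_embedding_RUnit:
  assumes "X \<in> Obj C" "e \<in> unit_End"
  shows "right_embedding C X e \<cdot> RUnit C X = RUnit C X \<cdot> (Id C X \<boxtimes> e)"
  using assms by (auto simp: right_embedding_def Hom_iff)

text \<open>Naturality of the left unit constraint turns f into id \<otimes> f, which commutes with
  e \<otimes> id by interchange.\<close>

lemma left_embedding_natural:
  assumes f: "f \<in> Hom C X Y" and e: "e \<in> unit_End"
  shows "f \<cdot> left_embedding C X e = left_embedding C Y e \<cdot> f"
proof -
  have obj: "X \<in> Obj C" "Y \<in> Obj C" using Hom_imp_Obj[OF f] by auto
  note arr = f[unfolded Hom_iff] e[unfolded Hom_iff]
  have "(f \<cdot> left_embedding C X e) \<cdot> LUnit C X = (f \<cdot> LUnit C X) \<cdot> (e \<boxtimes> Id C X)"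
    using arr obj e by (simp add: left_embedding_LUnit)
  also have "\<dots> = LUnit C Y \<cdot> ((Id C (UnitO C) \<boxtimes> f) \<cdot> (e \<boxtimes> Id C X))"
    unfolding LUnit_natural[OF f, symmetric] using arr obj by simp
  also have "\<dots> = LUnit C Y \<cdot> ((e \<boxtimes> Id C Y) \<cdot> (Id C (UnitO C) \<boxtimes> f))"
    using arr obj by (simp add: Ten_Comp)
  also have "\<dots> = (left_embedding C Y e \<cdot> LUnit C Y) \<cdot> (Id C (UnitO C) \<boxtimes> f)"
    unfolding left_embedding_LUnit[OF obj(2) e] using arr obj by simp
  also have "\<dots> = (left_embedding C Y e \<cdot> f) \<cdot> LUnit C X"
    using arr obj e LUnit_natural[OF f] by simp
  finally show ?thesis
    using arr obj e by - (rule iso_cancel_right[of "LUnit C X"]; simp)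
qed

text \<open>Mirror image with the right unit constraint. For f = \<lambda>_X(J) it says that the two
  actions on X commute.\<close>

lemma right_embedding_natural:
  assumes f: "f \<in> Hom C X Y" and e: "e \<in> unit_End"
  shows "f \<cdot> right_embedding C X e = right_embedding C Y e \<cdot> f"
proof -
  have obj: "X \<in> Obj C" "Y \<in> Obj C" using Hom_imp_Obj[OF f] by auto
  note arr = f[unfolded Hom_iff] e[unfolded Hom_iff]
  have "(f \<cdot> right_embedding C X e) \<cdot> RUnit C X = (f \<cdot> RUnit C X) \<cdot> (Id C X \<boxtimes> e)"
    using arr obj e by (simp add: right_embedding_RUnit)
  also have "\<dots> = RUnit C Y \<cdot> ((f \<boxtimes> Id C (UnitO C)) \<cdot> (Id C X \<boxtimes> e))"
    unfolding RUnit_natural[OF f, symmetric] using arr obj by simp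
  also have "\<dots> = RUnit C Y \<cdot> ((Id C Y \<boxtimes> e) \<cdot> (f \<boxtimes> Id C (UnitO C)))"
    using arr obj by (simp add: Ten_Comp)
  also have "\<dots> = (right_embedding C Y e \<cdot> RUnit C Y) \<cdot> (f \<boxtimes> Id C (UnitO C))"
    unfolding right_embedding_RUnit[OF obj(2) e] using arr obj by simp
  also have "\<dots> = (right_embedding C Y e \<cdot> f) \<cdot> RUnit C X"
    using arr obj e RUnit_natural[OF f] by simp
  finally show ?thesis
    using arr obj e by - (rule iso_cancel_right[of "RUnit C X"]; simp)
qed

lemma left_embedding_Comp:
  assumes X: "X \<in> Obj C" and e: "e \<in> unit_End" "e' \<in> unit_End"
  shows "left_embedding C X (e \<cdot> e') = left_embedding C X e \<cdot> left_embedding C X e'"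
proof -
  have "(e \<cdot> e') \<boxtimes> Id C X = (e \<boxtimes> Id C X) \<cdot> (e' \<boxtimes> Id C X)"
    using X e by (simp add: Ten_Comp Hom_iff)
  thus ?thesis
    using X e by (auto simp: left_embedding_def Hom_iff)
qed

lemma right_embedding_Comp:
  assumes X: "X \<in> Obj C" and e: "e \<in> unit_End" "e' \<in> unit_End"
  shows "right_embedding C X (e \<cdot> e') = right_embedding C X e \<cdot> right_embedding C X e'"
proof -
  have "Id C X \<boxtimes> (e \<cdot> e') = (Id C X \<boxtimes> e) \<cdot> (Id C X \<boxtimes> e')"
    using X e by (simp add: Ten_Comp Hom_iff)
  thus ?thesis
    using X e by (auto simp: right_embedding_def Hom_iff)
qed

lemma embedding_Id:
  assumes "X \<in> Obj C"
  shows "left_embedding C X (Id C (UnitO C)) = Id C X" "right_embedding C X (Id C (UnitO C)) = Id C X"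
  using assms by (auto simp: left_embedding_def right_embedding_def TenA_Id)

text \<open>Kelly's coherence \<open>\<ell>\<^sub>X\<^sub>Y \<circ> \<alpha> = \<ell>\<^sub>X \<otimes> id\<close> is not needed: the two sides differ by an automorphism of
  \<open>X \<otimes> Y\<close>, with which the natural transformation \<open>\<lambda>(e)\<close> commutes.\<close>

lemma left_embedding_Ten:
  assumes obj: "X \<in> Obj C" "Y \<in> Obj C" and e: "e \<in> unit_End"
  shows "left_embedding C (X \<boxdot> Y) e = left_embedding C X e \<boxtimes> Id C Y"
proof -
  let ?l = "LUnit C X" and ?L = "left_embedding C X e" and ?LL = "left_embedding C (X \<boxdot> Y) e"
    and ?a = "Assoc C (UnitO C) X Y" and ?ll = "LUnit C (X \<boxdot> Y)"
  let ?w = "?ll \<cdot> (?a \<cdot> (inv_arrow C ?l \<boxtimes> Id C Y))"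
  have arr: "e \<in> Arr C" "Dom C e = UnitO C" "Cod C e = UnitO C"
    using e by (auto simp: Hom_iff)
  have w: "?w \<in> Hom C (X \<boxdot> Y) (X \<boxdot> Y)" using obj by (simp add: Hom_iff)
  have iso: "iso_arrow C ?w"
    using obj by (intro iso_Comp iso_Ten iso_inv iso_Id) auto
  have "?w \<cdot> (?L \<boxtimes> Id C Y) = ?ll \<cdot> (?a \<cdot> ((inv_arrow C ?l \<cdot> ?L) \<boxtimes> Id C Y))"
    using obj e arr by (simp add: Ten_Comp)
  also have "inv_arrow C ?l \<cdot> ?L = (e \<boxtimes> Id C X) \<cdot> inv_arrow C ?l"
    using obj arr by (simp add: left_embedding_def)
  also have "((e \<boxtimes> Id C X) \<cdot> inv_arrow C ?l) \<boxtimes> Id C Y =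
      ((e \<boxtimes> Id C X) \<boxtimes> Id C Y) \<cdot> (inv_arrow C ?l \<boxtimes> Id C Y)"
    using obj arr by (simp add: Ten_Comp)
  also have "?ll \<cdot> (?a \<cdot> (((e \<boxtimes> Id C X) \<boxtimes> Id C Y) \<cdot> (inv_arrow C ?l \<boxtimes> Id C Y))) =
      ?ll \<cdot> ((?a \<cdot> ((e \<boxtimes> Id C X) \<boxtimes> Id C Y)) \<cdot> (inv_arrow C ?l \<boxtimes> Id C Y))"
    using obj arr by simp
  also have "?a \<cdot> ((e \<boxtimes> Id C X) \<boxtimes> Id C Y) = (e \<boxtimes> (Id C X \<boxtimes> Id C Y)) \<cdot> ?a"
    using e obj by (intro Assoc_natural Id_in_Hom)
  also have "?ll \<cdot> (((e \<boxtimes> (Id C X \<boxtimes> Id C Y)) \<cdot> ?a) \<cdot> (inv_arrow C ?l \<boxtimes> Id C Y)) =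
      (?ll \<cdot> (e \<boxtimes> Id C (X \<boxdot> Y))) \<cdot> (?a \<cdot> (inv_arrow C ?l \<boxtimes> Id C Y))"
    using obj arr by (simp add: TenA_Id)
  also have "?ll \<cdot> (e \<boxtimes> Id C (X \<boxdot> Y)) = ?LL \<cdot> ?ll"
    using obj e by (simp add: left_embedding_LUnit)
  also have "(?LL \<cdot> ?ll) \<cdot> (?a \<cdot> (inv_arrow C ?l \<boxtimes> Id C Y)) = ?LL \<cdot> ?w"
    using obj e by simp
  also have "\<dots> = ?w \<cdot> ?LL"
    using left_embedding_natural[OF w e] by simp
  finally show ?thesis
    using obj e iso by - (rule iso_cancel_left[of ?w ?LL, OF iso]; simp)
qed

text \<open>As for the left embedding: \<open>?w\<close> compares id \<otimes> r_Y with the right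
  unit constraint of the product, \<rho>(e) commutes with \<open>?w\<close> by naturality, and the
  automorphism \<open>?w\<close> cancels.\<close>

lemma right_embedding_Ten:
  assumes obj: "X \<in> Obj C" "Y \<in> Obj C" and e: "e \<in> unit_End"
  shows "right_embedding C (X \<boxdot> Y) e = Id C X \<boxtimes> right_embedding C Y e"
proof -
  let ?r = "RUnit C Y" and ?R = "right_embedding C Y e" and ?RR = "right_embedding C (X \<boxdot> Y) e"
    and ?a = "Assoc C X Y (UnitO C)" and ?rr = "RUnit C (X \<boxdot> Y)"
  let ?w = "((Id C X \<boxtimes> ?r) \<cdot> ?a) \<cdot> inv_arrow C ?rr"
  have arr: "e \<in> Arr C" "Dom C e = UnitO C" "Cod C e = UnitO C"
    using e by (auto simp: Hom_iff)
  have w: "?w \<in> Hom C (X \<boxdot> Y) (X \<boxdot> Y)" using obj by (simp add: Hom_iff)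
  have iso: "iso_arrow C ?w"
    using obj by (intro iso_Comp iso_Ten iso_inv iso_Id) auto
  have "?RR \<cdot> ?w = ?w \<cdot> ?RR"
    using right_embedding_natural[OF w e] by simp
  also have "\<dots> = (Id C X \<boxtimes> ?r) \<cdot> (?a \<cdot> (inv_arrow C ?rr \<cdot> ?RR))"
    using obj e by simp
  also have "inv_arrow C ?rr \<cdot> ?RR = (Id C (X \<boxdot> Y) \<boxtimes> e) \<cdot> inv_arrow C ?rr"
    using obj arr by (simp add: right_embedding_def)
  also have "(Id C X \<boxtimes> ?r) \<cdot> (?a \<cdot> ((Id C (X \<boxdot> Y) \<boxtimes> e) \<cdot> inv_arrow C ?rr)) =
      (Id C X \<boxtimes> ?r) \<cdot> ((?a \<cdot> ((Id C X \<boxtimes> Id C Y) \<boxtimes> e)) \<cdot> inv_arrow C ?rr)"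
    using obj arr by (simp add: TenA_Id)
  also have "?a \<cdot> ((Id C X \<boxtimes> Id C Y) \<boxtimes> e) = (Id C X \<boxtimes> (Id C Y \<boxtimes> e)) \<cdot> ?a"
    using e obj by (intro Assoc_natural Id_in_Hom)
  also have "(Id C X \<boxtimes> ?r) \<cdot> (((Id C X \<boxtimes> (Id C Y \<boxtimes> e)) \<cdot> ?a) \<cdot> inv_arrow C ?rr) =
      ((Id C X \<boxtimes> ?r) \<cdot> (Id C X \<boxtimes> (Id C Y \<boxtimes> e))) \<cdot> (?a \<cdot> inv_arrow C ?rr)"
    using obj arr by simp
  also have "(Id C X \<boxtimes> ?r) \<cdot> (Id C X \<boxtimes> (Id C Y \<boxtimes> e)) = (Id C X \<boxtimes> ?R) \<cdot> (Id C X \<boxtimes> ?r)"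
    using obj arr e by (simp add: Ten_Comp right_embedding_RUnit)
  also have "((Id C X \<boxtimes> ?R) \<cdot> (Id C X \<boxtimes> ?r)) \<cdot> (?a \<cdot> inv_arrow C ?rr) = (Id C X \<boxtimes> ?R) \<cdot> ?w"
    using obj arr e by simp
  finally show ?thesis
    using obj e by - (rule iso_cancel_right[of ?w ?RR, OF iso]; simp)
qed

text \<open>By the triangle axiom, r_X \<otimes> id and id \<otimes> l_Y absorb the same middle
  unit, up to the associator. An endomorphism of that unit acts as \<rho> on the left factor and as
  \<lambda> on the right one.\<close>

lemma middle_embedding:
  assumes obj: "X \<in> Obj C" "Y \<in> Obj C" and e: "e \<in> unit_End"
  shows "right_embedding C X e \<boxtimes> Id C Y = Id C X \<boxtimes> left_embedding C Y e"
proof -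
  let ?r = "RUnit C X \<boxtimes> Id C Y" and ?l = "Id C X \<boxtimes> LUnit C Y" and ?a = "Assoc C X (UnitO C) Y"
    and ?R = "right_embedding C X e" and ?L = "left_embedding C Y e"
  have arr: "e \<in> Arr C" "Dom C e = UnitO C" "Cod C e = UnitO C"
    using e by (auto simp: Hom_iff)
  have tri: "?l \<cdot> ?a = ?r" using triangle[OF obj] .
  have "(?R \<boxtimes> Id C Y) \<cdot> ?r = ?r \<cdot> ((Id C X \<boxtimes> e) \<boxtimes> Id C Y)"
    using obj arr e by (simp add: Ten_Comp right_embedding_RUnit)
  also have "\<dots> = ?l \<cdot> (?a \<cdot> ((Id C X \<boxtimes> e) \<boxtimes> Id C Y))"
    unfolding tri[symmetric] using obj arr by simp
  also have "?a \<cdot> ((Id C X \<boxtimes> e) \<boxtimes> Id C Y) = (Id C X \<boxtimes> (e \<boxtimes> Id C Y)) \<cdot> ?a"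
    using e obj by (intro Assoc_natural Id_in_Hom)
  also have "?l \<cdot> ((Id C X \<boxtimes> (e \<boxtimes> Id C Y)) \<cdot> ?a) = (?l \<cdot> (Id C X \<boxtimes> (e \<boxtimes> Id C Y))) \<cdot> ?a"
    using obj arr by simp
  also have "?l \<cdot> (Id C X \<boxtimes> (e \<boxtimes> Id C Y)) = (Id C X \<boxtimes> ?L) \<cdot> ?l"
    using obj arr e by (simp add: Ten_Comp left_embedding_LUnit)
  also have "((Id C X \<boxtimes> ?L) \<cdot> ?l) \<cdot> ?a = (Id C X \<boxtimes> ?L) \<cdot> (?l \<cdot> ?a)"
    using obj arr e by simp
  also have "\<dots> = (Id C X \<boxtimes> ?L) \<cdot> ?r" by (simp only: tri)
  finally show ?thesis
    using obj e by - (rule iso_cancel_right[of ?r, OF iso_Ten[OF _ iso_Id]]; simp)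
qed

text \<open>An Eckmann-Hilton argument: e \<otimes> id and id \<otimes> f commute. The two unit
  constraints on 1 are not assumed equal, so \<open>key\<close> only says that \<open>e\<close>
  commutes with the conjugate of \<open>f\<close> by the automorphism \<open>?c\<close>.\<close>

lemma unit_endo_commute:
  assumes "e \<in> unit_End" "f \<in> unit_End"
  shows "e \<cdot> f = f \<cdot> e"
proof -
  let ?l = "LUnit C (UnitO C)" and ?r = "RUnit C (UnitO C)" and ?i = "Id C (UnitO C)"
  let ?c = "?r \<cdot> inv_arrow C ?l" and ?c' = "?l \<cdot> inv_arrow C ?r"
  have key: "e \<cdot> (?c \<cdot> (f \<cdot> ?c')) = ?c \<cdot> (f \<cdot> (?c' \<cdot> e))" if "e \<in> unit_End" "f \<in> unit_End" for e f
  proof -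
    have arr: "e \<in> Arr C" "Dom C e = UnitO C" "Cod C e = UnitO C"
       "f \<in> Arr C" "Dom C f = UnitO C" "Cod C f = UnitO C"
      using that by (auto simp: Hom_iff)
    have e1: "e \<boxtimes> ?i = inv_arrow C ?r \<cdot> (e \<cdot> ?r)"
      unfolding RUnit_natural[OF that(1), symmetric] using arr by simp
    have f1: "?i \<boxtimes> f = inv_arrow C ?l \<cdot> (f \<cdot> ?l)"
      unfolding LUnit_natural[OF that(2), symmetric] using arr by simp
    have "e \<cdot> (?c \<cdot> (f \<cdot> ?c')) = ?r \<cdot> (((e \<boxtimes> ?i) \<cdot> (?i \<boxtimes> f)) \<cdot> inv_arrow C ?r)"
      unfolding e1 f1 using arr by simp
    also have "(e \<boxtimes> ?i) \<cdot> (?i \<boxtimes> f) = (?i \<boxtimes> f) \<cdot> (e \<boxtimes> ?i)"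
      using arr by (simp add: Ten_Comp)
    also have "?r \<cdot> (((?i \<boxtimes> f) \<cdot> (e \<boxtimes> ?i)) \<cdot> inv_arrow C ?r) = ?c \<cdot> (f \<cdot> (?c' \<cdot> e))"
      unfolding e1 f1 using arr by simp
    finally show ?thesis .
  qed
  have arr: "e \<in> Arr C" "Dom C e = UnitO C" "Cod C e = UnitO C"
     "f \<in> Arr C" "Dom C f = UnitO C" "Cod C f = UnitO C"
    using assms by (auto simp: Hom_iff)
  \<comment> \<open>Conjugating \<open>f\<close> backwards beforehand undoes the twist by
    \<open>?c\<close> in \<open>key\<close>.\<close>
  let ?f = "?c' \<cdot> (f \<cdot> ?c)"
  have f': "?f \<in> unit_End" using arr by (simp add: Hom_iff)
  have "e \<cdot> f = e \<cdot> (?c \<cdot> (?f \<cdot> ?c'))" using arr by simp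
  also have "\<dots> = ?c \<cdot> (?f \<cdot> (?c' \<cdot> e))" by (rule key[OF assms(1) f'])
  also have "\<dots> = f \<cdot> e" using arr by simp
  finally show ?thesis .
qed

text \<open>Naturality makes e \<otimes> id the conjugate of \<open>e\<close> by r, and id \<otimes>
  e the conjugate by l. Each embedding thus conjugates \<open>e\<close> by an automorphism of 1,
  which changes nothing since End(1) is commutative.\<close>

lemma unit_embedding:
  assumes "e \<in> unit_End"
  shows "left_embedding C (UnitO C) e = e" "right_embedding C (UnitO C) e = e"
proof -
  let ?l = "LUnit C (UnitO C)" and ?r = "RUnit C (UnitO C)" and ?i = "Id C (UnitO C)"
  have arr: "e \<in> Arr C" "Dom C e = UnitO C" "Cod C e = UnitO C"
    using assms by (auto simp: Hom_iff)
  have e1: "e \<boxtimes> ?i = inv_arrow C ?r \<cdot> (e \<cdot> ?r)" and e2: "?i \<boxtimes> e = inv_arrow C ?l \<cdot> (e \<cdot> ?l)"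
    unfolding RUnit_natural[OF assms, symmetric] LUnit_natural[OF assms, symmetric] using arr by auto
  have "left_embedding C (UnitO C) e = ?l \<cdot> (inv_arrow C ?r \<cdot> (e \<cdot> (?r \<cdot> inv_arrow C ?l)))"
    unfolding left_embedding_def e1 using arr by simp
  also have "e \<cdot> (?r \<cdot> inv_arrow C ?l) = (?r \<cdot> inv_arrow C ?l) \<cdot> e"
    by (rule unit_endo_commute[OF assms]) (simp add: Hom_iff)
  also have "?l \<cdot> (inv_arrow C ?r \<cdot> ((?r \<cdot> inv_arrow C ?l) \<cdot> e)) = e" using arr by simp
  finally show "left_embedding C (UnitO C) e = e" .
  have "right_embedding C (UnitO C) e = ?r \<cdot> (inv_arrow C ?l \<cdot> (e \<cdot> (?l \<cdot> inv_arrow C ?r)))"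
    unfolding right_embedding_def e2 using arr by simp
  also have "e \<cdot> (?l \<cdot> inv_arrow C ?r) = (?l \<cdot> inv_arrow C ?r) \<cdot> e"
    by (rule unit_endo_commute[OF assms]) (simp add: Hom_iff)
  also have "?r \<cdot> (inv_arrow C ?l \<cdot> ((?l \<cdot> inv_arrow C ?r) \<cdot> e)) = e" using arr by simp
  finally show "right_embedding C (UnitO C) e = e" .
qed

end

section \<open>The grading\<close>

locale real_fusion_category = fusion_category "class_ring :: real ring" C
  for C :: "('o, 'm, real, 'z) monoidal_cat_scheme" (structure)

sublocale real_fusion_category \<subseteq> real_linear_category C ..

context real_fusion_category
begin

lemma embedding_Add:
  assumes "X \<in> Obj C" "e \<in> unit_End" "e' \<in> unit_End"
  shows "left_embedding C X (AddA C e e') = AddA C (left_embedding C X e) (left_embedding C X e')"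
    and "right_embedding C X (AddA C e e') = AddA C (right_embedding C X e) (right_embedding C X e')"
  using assms TenA_add_left[OF assms(2,3) Id_in_Hom] TenA_add_right[OF Id_in_Hom assms(2,3)]
  by (auto simp: left_embedding_def right_embedding_def Hom_iff)

lemma embedding_Scale:
  assumes "X \<in> Obj C" "e \<in> unit_End"
  shows "left_embedding C X (ScaleA C a e) = ScaleA C a (left_embedding C X e)"
    and "right_embedding C X (ScaleA C a e) = ScaleA C a (right_embedding C X e)"
  using assms TenA_scale_left[of a, OF _ assms(2) Id_in_Hom] TenA_scale_right[of a, OF _ Id_in_Hom assms(2)]
  by (auto simp: left_embedding_def right_embedding_def Hom_iff)

lemma unit_not_zero: "\<not> zero_object C (UnitO C)"
  using simple_unit by (simp add: simple_object_def)

text \<open>The embeddings agree on real multiples of the identity, so where they differ on e they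
  also differ on the shift d = e + a with d^2 = -b^2, and on its multiple d / b.\<close>

lemma ex_imaginary_unit:
  assumes X: "X \<in> Obj C" and nt: "galois_nontrivial C X"
  obtains J where "J \<in> unit_End" "J \<cdot> J = ScaleA C (-1) (Id C (UnitO C))"
    "left_embedding C X J \<noteq> right_embedding C X J"
proof -
  let ?i = "Id C (UnitO C)"
  obtain e where e: "e \<in> unit_End" and ne: "left_embedding C X e \<noteq> right_embedding C X e"
    using nt by (auto simp: galois_trivial_def)
  have dom: "a = ZeroA C (UnitO C) (UnitO C) \<or> b = ZeroA C (UnitO C) (UnitO C)"
    if "a \<in> unit_End" "b \<in> unit_End" "a \<cdot> b = ZeroA C (UnitO C) (UnitO C)" for a b
    using simple_endo_no_zero_divisors[OF simple_unit] that by blast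
  have nz: "?i \<noteq> ZeroA C (UnitO C) (UnitO C)"
    using Id_eq_Zero_imp_zero_object unit_not_zero by auto
  have iE: "?i \<in> unit_End" by (simp add: Hom_iff)
  obtain a b where ab: "AddA C e (ScaleA C a ?i) \<cdot> AddA C e (ScaleA C a ?i) = ScaleA C (-(b^2)) ?i"
    using ex_real_quadratic[OF e fin_dim_hom[OF structure_arr(1) structure_arr(1)] nz dom] by blast
  define d where "d = AddA C e (ScaleA C a ?i)"
  have d: "d \<in> unit_End" using e iE by (auto simp: d_def Hom_iff)
  have e_d: "e = AddA C d (ScaleA C (-a) ?i)"
    using e by (auto simp: d_def Add_ac Scale_simps Hom_iff)
  have nd: "left_embedding C X d \<noteq> right_embedding C X d"
  proof
    assume "left_embedding C X d = right_embedding C X d"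
    moreover have "ScaleA C (-a) ?i \<in> unit_End" using iE by (simp add: Hom_iff)
    ultimately have "left_embedding C X e = right_embedding C X e"
      using X d iE by (simp add: e_d embedding_Add embedding_Scale embedding_Id)
    thus False using ne by simp
  qed
  \<comment> \<open>Otherwise d^2 = 0 forces d = 0, and the embeddings agree on zero.\<close>
  have "b \<noteq> 0"
  proof
    assume "b = 0"
    hence "d \<cdot> d = ZeroA C (UnitO C) (UnitO C)" using ab by (simp add: d_def Scale_simps)
    hence "d = ScaleA C 0 ?i" using dom[OF d d] by (simp add: Scale_simps)
    thus False using nd X iE by (simp add: embedding_Scale embedding_Id)
  qed
  define J where "J = ScaleA C (1/b) d"
  have J: "J \<in> unit_End" using d by (auto simp: J_def Hom_iff)
  have "J \<cdot> J = ScaleA C (1/b) (ScaleA C (1/b) (d \<cdot> d))" using d by (simp add: J_def Hom_iff)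
  hence JJ: "J \<cdot> J = ScaleA C (-1) ?i"
    using \<open>b \<noteq> 0\<close> ab by (simp add: d_def Scale_simps power2_eq_square)
  have "d = ScaleA C b J" using \<open>b \<noteq> 0\<close> d by (simp add: J_def Scale_simps Hom_iff)
  hence "left_embedding C X J \<noteq> right_embedding C X J"
    using nd X J by (auto simp: embedding_Scale)
  thus thesis using that[OF J JJ] by blast
qed

section \<open>Objects on which the two actions of J agree up to a sign\<close>

context
  fixes J
  assumes J: "J \<in> unit_End" and JJ: "J \<cdot> J = ScaleA C (-1) (Id C (UnitO C))"
begin

text \<open>The real parameter lets signs multiply under tensor products. As J^2 = -1, nonzero
  objects can occur only for s = 1 and s = -1.\<close>

definition eigen_objects :: "real \<Rightarrow> 'o set" where
  "eigen_objects s = {X \<in> Obj C. left_embedding C X J = ScaleA C s (right_embedding C X J)}"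

abbreviation lmul where "lmul X \<equiv> left_embedding C X J"
abbreviation rmul where "rmul X \<equiv> right_embedding C X J"

lemma lr_Hom: "X \<in> Obj C \<Longrightarrow> lmul X \<in> Hom C X X" "X \<in> Obj C \<Longrightarrow> rmul X \<in> Hom C X X"
  using J by (auto simp: Hom_iff)

lemma lr_arr [simp]:
  "X \<in> Obj C \<Longrightarrow> lmul X \<in> Arr C" "X \<in> Obj C \<Longrightarrow> Dom C (lmul X) = X" "X \<in> Obj C \<Longrightarrow> Cod C (lmul X) = X"
  "X \<in> Obj C \<Longrightarrow> rmul X \<in> Arr C" "X \<in> Obj C \<Longrightarrow> Dom C (rmul X) = X" "X \<in> Obj C \<Longrightarrow> Cod C (rmul X) = X"
  using lr_Hom[of X] by (auto simp: Hom_iff)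

lemma lr_square:
  assumes "X \<in> Obj C"
  shows "lmul X \<cdot> lmul X = ScaleA C (-1) (Id C X)" "rmul X \<cdot> rmul X = ScaleA C (-1) (Id C X)"
  using assms left_embedding_Comp[OF assms J J] right_embedding_Comp[OF assms J J]
    embedding_Scale[OF assms Id_in_Hom] embedding_Id[OF assms]
  by (auto simp: JJ)

lemma eigen_objects_Obj: "X \<in> eigen_objects s \<Longrightarrow> X \<in> Obj C"
  by (simp add: eigen_objects_def)

lemma eigen_objectsD: "X \<in> eigen_objects s \<Longrightarrow> lmul X = ScaleA C s (rmul X)"
  by (simp add: eigen_objects_def)

text \<open>Moving \<open>f\<close> past both actions gives (s - t) \<rho>_Y(J) f = 0, and
  \<rho>_Y(J) is invertible with inverse -\<rho>_Y(J).\<close>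

lemma eigen_objects_orthogonal:
  assumes X: "X \<in> eigen_objects s" and Y: "Y \<in> eigen_objects t" and st: "s \<noteq> t" and f: "f \<in> Hom C X Y"
  shows "f = ZeroA C X Y"
proof -
  have obj: "X \<in> Obj C" "Y \<in> Obj C" using X Y eigen_objects_Obj by auto
  have "ScaleA C s (rmul Y \<cdot> f) = f \<cdot> lmul X"
    using f obj by (simp add: eigen_objectsD[OF X] Hom_iff flip: right_embedding_natural[OF f J])
  also have "\<dots> = ScaleA C t (rmul Y \<cdot> f)"
    using f obj by (simp add: left_embedding_natural[OF f J] eigen_objectsD[OF Y] Hom_iff)
  finally have *: "ScaleA C s (rmul Y \<cdot> f) = ScaleA C t (rmul Y \<cdot> f)" .
  have rf: "rmul Y \<cdot> f \<in> Arr C" "Dom C (rmul Y \<cdot> f) = X" "Cod C (rmul Y \<cdot> f) = Y"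
    using f obj by (auto simp: Hom_iff)
  have "ScaleA C (s - t) (rmul Y \<cdot> f) = AddA C (ScaleA C s (rmul Y \<cdot> f)) (ScaleA C (-t) (rmul Y \<cdot> f))"
    using rf(1) by (simp add: Scale_simps)
  also have "\<dots> = ZeroA C X Y"
    using rf by (simp only: *) (simp add: Scale_simps)
  finally have "rmul Y \<cdot> f = ZeroA C X Y"
    using Scale_eq_zero[OF rf(1), of "s - t"] rf st by simp
  moreover have "f = ScaleA C (-1) ((rmul Y \<cdot> rmul Y) \<cdot> f)"
    using f obj unfolding lr_square(2)[OF obj(2)] by (simp add: Scale_simps Hom_iff)
  moreover have "(rmul Y \<cdot> rmul Y) \<cdot> f = rmul Y \<cdot> (rmul Y \<cdot> f)" using f obj by (simp add: Hom_iff)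
  ultimately show ?thesis using obj by (metis Comp_Zero_right Scale_zero_right lr_arr(4-6))
qed

text \<open>Naturality transports the defining equation along morphisms: a monic or an epic then
  cancels, and on a direct sum it suffices to compare after the inclusions.\<close>

lemma closed_subcategory_eigen_objects: "closed_subcategory class_ring C (eigen_objects s)"
proof
  show "eigen_objects s \<subseteq> Obj C" by (auto simp: eigen_objects_def)
  fix Z assume Z: "zero_object C Z"
  hence obj: "Z \<in> Obj C" by (simp add: zero_object_def)
  have "lmul Z = ZeroA C Z Z" "rmul Z = ZeroA C Z Z"
    using Hom_zero_object[OF Z] lr_Hom[OF obj] by blast+
  thus "Z \<in> eigen_objects s" using obj by (simp add: eigen_objects_def)
next
  fix m A X assume m: "m \<in> Hom C A X" "monic C m" and X: "X \<in> eigen_objects s"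
  have obj: "A \<in> Obj C" "X \<in> Obj C" using Hom_imp_Obj[OF m(1)] by auto
  have "m \<cdot> lmul A = ScaleA C s (rmul X) \<cdot> m"
    by (simp add: left_embedding_natural[OF m(1) J] eigen_objectsD[OF X])
  also have "\<dots> = m \<cdot> ScaleA C s (rmul A)"
    using m(1) obj right_embedding_natural[OF m(1) J] by (simp add: Hom_iff)
  finally have "lmul A = ScaleA C s (rmul A)"
    using obj monicD[OF m(2,1), of "lmul A" A "ScaleA C s (rmul A)"] by (simp add: Hom_iff)
  thus "A \<in> eigen_objects s" using obj by (simp add: eigen_objects_def)
next
  fix e X A assume e: "e \<in> Hom C X A" "epic C e" and X: "X \<in> eigen_objects s"
  have obj: "X \<in> Obj C" "A \<in> Obj C" using Hom_imp_Obj[OF e(1)] by auto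
  have "lmul A \<cdot> e = e \<cdot> ScaleA C s (rmul X)"
    by (simp add: eigen_objectsD[OF X] flip: left_embedding_natural[OF e(1) J])
  also have "\<dots> = ScaleA C s (rmul A) \<cdot> e"
    using e(1) obj right_embedding_natural[OF e(1) J] by (simp add: Hom_iff)
  finally have "lmul A = ScaleA C s (rmul A)"
    using obj epicD[OF e(2,1), of "lmul A" A "ScaleA C s (rmul A)"] by (simp add: Hom_iff)
  thus "A \<in> eigen_objects s" using obj by (simp add: eigen_objects_def)
next
  fix X Y P \<iota> \<pi>
  assume P: "is_direct_sum C (UNIV :: bool set) (\<lambda>b. if b then X else Y) P \<iota> \<pi>"
    and XY: "X \<in> eigen_objects s" "Y \<in> eigen_objects s"
  note H = is_direct_sum_Hom[OF P]
  have "lmul P = ScaleA C s (rmul P)"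
  proof (rule direct_sum_ext(1)[OF P])
    show "lmul P \<in> Hom C P P" "ScaleA C s (rmul P) \<in> Hom C P P" using H(2) by (auto simp: Hom_iff)
    fix b :: bool
    define Z where "Z = (if b then X else Y)"
    have Z: "Z \<in> eigen_objects s" "Z \<in> Obj C" and i: "\<iota> b \<in> Hom C Z P"
      using XY eigen_objects_Obj H(4)[of b] by (auto simp: Z_def)
    have "lmul P \<cdot> \<iota> b = \<iota> b \<cdot> ScaleA C s (rmul Z)"
      by (simp add: eigen_objectsD[OF Z(1)] flip: left_embedding_natural[OF i J])
    thus "lmul P \<cdot> \<iota> b = ScaleA C s (rmul P) \<cdot> \<iota> b"
      using i Z H(2) right_embedding_natural[OF i J] by (simp add: Hom_iff)
  qed
  thus "P \<in> eigen_objects s" using H(2) by (simp add: eigen_objects_def)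
qed

text \<open>The action of J travels through the product from left to right: \<lambda> on the left
  factor is s \<rho>, which equals s times \<lambda> on the right factor, and that is t
  \<rho>.\<close>

lemma eigen_objects_Ten:
  assumes X: "X \<in> eigen_objects s" and Y: "Y \<in> eigen_objects t"
  shows "X \<boxdot> Y \<in> eigen_objects (s * t)"
proof -
  have obj: "X \<in> Obj C" "Y \<in> Obj C" using X Y eigen_objects_Obj by auto
  have "lmul (X \<boxdot> Y) = ScaleA C s (rmul X) \<boxtimes> Id C Y"
    by (simp add: left_embedding_Ten[OF obj J] eigen_objectsD[OF X])
  also have "\<dots> = ScaleA C s (Id C X \<boxtimes> lmul Y)"
    unfolding middle_embedding[OF obj J, symmetric]
    by (rule TenA_scale_left[OF _ lr_Hom(2)[OF obj(1)] Id_in_Hom[OF obj(2)]]) simp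
  also have "Id C X \<boxtimes> lmul Y = ScaleA C t (Id C X \<boxtimes> rmul Y)"
    unfolding eigen_objectsD[OF Y]
    by (rule TenA_scale_right[OF _ Id_in_Hom[OF obj(1)] lr_Hom(2)[OF obj(2)]]) simp
  finally show ?thesis
    using obj by (simp add: eigen_objects_def right_embedding_Ten[OF obj J] Scale_simps)
qed

lemma unit_in_eigen_objects: "UnitO C \<in> eigen_objects 1"
  using J by (simp add: eigen_objects_def unit_embedding Scale_simps Hom_iff)

lemma decomposition:
  assumes X: "X \<in> Obj C" and ab: "a \<noteq> b"
  shows "\<exists>Xs \<iota> \<pi>. is_direct_sum C {a, b} Xs X \<iota> \<pi> \<and> Xs a \<in> eigen_objects 1 \<and> Xs b \<in> eigen_objects (-1)"
proof -
  define t where "t = lmul X \<cdot> rmul X"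
  have t: "t \<in> Hom C X X" using X by (simp add: t_def Hom_iff)
  note tarr = t[unfolded Hom_iff] X
  have comm: "lmul X \<cdot> rmul X = rmul X \<cdot> lmul X"
    using right_embedding_natural[OF lr_Hom(1)[OF X] J] .
  \<comment> \<open>Multiplication by t exchanges the two actions up to sign, because each of them
    squares to -1.\<close>
  have lt: "lmul X \<cdot> t = ScaleA C (-1) (rmul X)"
    using X lr_square(1)[OF X] by (simp add: t_def flip: Comp_assoc'[of "rmul X" "lmul X" "lmul X"])
  have rt: "rmul X \<cdot> t = ScaleA C (-1) (lmul X)"
    using X lr_square(2)[OF X] by (simp add: t_def comm flip: Comp_assoc'[of "lmul X" "rmul X" "rmul X"])
  have tt: "t \<cdot> t = Id C X"
  proof -
    have "t \<cdot> t = lmul X \<cdot> (rmul X \<cdot> t)" using X t by (simp add: t_def)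
    also have "\<dots> = Id C X" using X by (simp add: rt lr_square Scale_simps)
    finally show ?thesis .
  qed
  \<comment> \<open>As \<rho>^2 = -1, the case t = -1 is \<lambda> = \<rho>. Hence (1 - t)/2 belongs
    to sign 1 and (1 + t)/2 to sign -1.\<close>
  define p where "p = AddA C (ScaleA C (1/2) (Id C X)) (ScaleA C (-1/2) t)"
  define q where "q = AddA C (ScaleA C (1/2) (Id C X)) (ScaleA C (1/2) t)"
  have pq: "p \<in> Hom C X X" "q \<in> Hom C X X" using tarr by (auto simp: p_def q_def Hom_iff)
  have "p \<cdot> q = ZeroA C X X" "q \<cdot> p = ZeroA C X X"
    using tarr by (auto simp: p_def q_def tt Scale_simps Add_ac)
  moreover have "AddA C p q = Id C X"
    using tarr Scale_span_simps[OF Id_in_Hom[OF X] t, of "1/2" "-1/2" "1/2" "1/2"]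
    by (simp add: p_def q_def Scale_simps)
  ultimately obtain Xs \<iota> \<pi> where S: "is_direct_sum C {a, b} Xs X \<iota> \<pi>"
    and pi: "p \<cdot> \<iota> a = \<iota> a" and qi: "q \<cdot> \<iota> b = \<iota> b"
    using complementary_idempotents_split[OF pq _ _ _ ab] by blast
  have lp: "lmul X \<cdot> p = rmul X \<cdot> p"
    using tarr by (simp add: p_def lt rt Scale_simps Add_ac)
  have lq: "lmul X \<cdot> q = ScaleA C (-1) (rmul X \<cdot> q)"
    using tarr by (simp add: q_def lt rt Scale_simps Add_ac)
  \<comment> \<open>A relation on the image of \<open>e\<close> descends to the summand: naturality
    moves it to the source of \<open>i\<close>, and the retraction \<open>k\<close> removes
    \<open>i\<close>.\<close>
  have transfer: "A \<in> eigen_objects s"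
    if i: "i \<in> Hom C A X" and k: "k \<in> Hom C X A" and ki: "k \<cdot> i = Id C A"
      and e: "e \<in> Hom C X X" "e \<cdot> i = i" "lmul X \<cdot> e = ScaleA C s (rmul X \<cdot> e)" for i k A e s
  proof -
    have A: "A \<in> Obj C" using Hom_imp_Obj[OF i] by simp
    have "i \<cdot> lmul A = lmul X \<cdot> (e \<cdot> i)" by (simp add: left_embedding_natural[OF i J] e(2))
    also have "\<dots> = (lmul X \<cdot> e) \<cdot> i" using i e(1) X by (simp add: Hom_iff)
    also have "\<dots> = ScaleA C s (rmul X \<cdot> (e \<cdot> i))" unfolding e(3) using i e(1) X by (simp add: Hom_iff)
    also have "\<dots> = i \<cdot> ScaleA C s (rmul A)"
      using i A right_embedding_natural[OF i J] by (simp add: e(2) Hom_iff)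
    finally have "(k \<cdot> i) \<cdot> lmul A = (k \<cdot> i) \<cdot> ScaleA C s (rmul A)"
      using i k A by (simp add: Hom_iff)
    thus ?thesis using A by (simp add: ki eigen_objects_def)
  qed
  note H = is_direct_sum_Hom[OF S]
  have retract: "\<pi> a \<cdot> \<iota> a = Id C (Xs a)" "\<pi> b \<cdot> \<iota> b = Id C (Xs b)"
    using S by (auto simp: is_direct_sum_def)
  have lp': "lmul X \<cdot> p = ScaleA C 1 (rmul X \<cdot> p)" using lp tarr pq by (simp add: Scale_simps Hom_iff)
  have "Xs a \<in> eigen_objects 1" "Xs b \<in> eigen_objects (-1)"
    using transfer[OF H(4,5)[of a] retract(1) pq(1) pi lp'] transfer[OF H(4,5)[of b] retract(2) pq(2) qi lq]
    by simp_all
  thus ?thesis using S by blast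
qed

text \<open>If every object of sign -1 were zero, the actions would agree on both summands of
  \<open>X\<close>, and by naturality on \<open>X\<close> itself.\<close>

lemma ex_nonzero_minus:
  assumes X: "X \<in> Obj C" and ne: "lmul X \<noteq> rmul X"
  shows "\<exists>Y \<in> eigen_objects (-1). \<not> zero_object C Y"
proof (rule ccontr)
  assume none: "\<not> ?thesis"
  obtain Xs \<iota> \<pi> where S: "is_direct_sum C {True, False} Xs X \<iota> \<pi>"
    and Xs: "Xs True \<in> eigen_objects 1" "Xs False \<in> eigen_objects (-1)"
    using decomposition[OF X, of True False] by auto
  note H = is_direct_sum_Hom[OF S]
  have "lmul X = rmul X"
  proof (rule direct_sum_ext(1)[OF S lr_Hom[OF X]])
    fix b :: bool
    have i: "\<iota> b \<in> Hom C (Xs b) X" and obj: "Xs b \<in> Obj C" using H(3,4)[of b] by (cases b; simp)+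
    have "lmul (Xs b) = rmul (Xs b)"
    proof (cases b)
      case True
      thus ?thesis using eigen_objectsD[OF Xs(1)] obj by (simp add: Scale_simps)
    next
      case False
      hence "zero_object C (Xs b)" using none Xs by auto
      thus ?thesis using Hom_zero_object lr_Hom[OF obj] by metis
    qed
    thus "lmul X \<cdot> \<iota> b = rmul X \<cdot> \<iota> b"
      by (simp flip: left_embedding_natural[OF i J] right_embedding_natural[OF i J])
  qed
  thus False using ne by simp
qed

end

end

section \<open>The Galois group of the complex numbers\<close>

text \<open>An automorphism fixing the reals is determined by its value at i, a square root of -1.
  As the carrier is the whole type, extensionality in \<open>Bij\<close> is vacuous and maps are
  compared as functions.\<close>

lemma carrier_Gal_complex_real: "carrier Gal_complex_real = {id, cnj}"
proof -
  let ?C = "class_ring :: complex ring"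
  have "\<sigma> = id \<or> \<sigma> = cnj" if "\<sigma> \<in> ring_iso ?C ?C" "\<forall>x\<in>\<real>. \<sigma> x = x" for \<sigma>
  proof -
    have add: "\<sigma> (x + y) = \<sigma> x + \<sigma> y" and mult: "\<sigma> (x * y) = \<sigma> x * \<sigma> y" for x y
      using that(1) by (auto simp: ring_iso_def Ring.ring_hom_def)
    have "\<sigma> \<i> * \<sigma> \<i> = \<sigma> (-1)" using mult[of \<i> \<i>] by simp
    also have "\<dots> = -1" using that(2) by simp
    finally have "(\<sigma> \<i> - \<i>) * (\<sigma> \<i> + \<i>) = 0" by (simp add: algebra_simps)
    hence "\<sigma> \<i> = \<i> \<or> \<sigma> \<i> = - \<i>" by (simp add: eq_neg_iff_add_eq_0)
    moreover have expand: "\<sigma> z = of_real (Re z) + \<sigma> \<i> * of_real (Im z)" for z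
    proof -
      have "\<sigma> z = \<sigma> (of_real (Re z) + \<i> * of_real (Im z))" by (simp flip: complex_eq)
      also have "\<dots> = \<sigma> (of_real (Re z)) + \<sigma> \<i> * \<sigma> (of_real (Im z))" by (simp only: add mult)
      finally show ?thesis using that(2) by simp
    qed
    ultimately show ?thesis
    proof (elim disjE)
      assume "\<sigma> \<i> = \<i>"
      hence "\<sigma> z = z" for z unfolding expand[of z] by (simp add: complex_eq_iff)
      thus ?thesis by auto
    next
      assume "\<sigma> \<i> = - \<i>"
      hence "\<sigma> z = cnj z" for z unfolding expand[of z] by (simp add: complex_eq_iff)
      thus ?thesis by auto
    qed
  qed
  moreover have "bij cnj" by (rule o_bij[of cnj]) (auto simp: fun_eq_iff)
  hence "id \<in> ring_iso ?C ?C" "cnj \<in> ring_iso ?C ?C"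
    "id \<in> Bij (UNIV :: complex set)" "cnj \<in> Bij UNIV"
    by (auto simp: ring_iso_def Ring.ring_hom_def Bij_def)
  ultimately show ?thesis
    by (auto simp: galois_group_def Reals_cnj_iff)
qed

text \<open>\<open>BijGroup\<close> multiplies members of \<open>Bij\<close> only and restricts the
  composite to the carrier; for bijections of the whole type neither restriction has an
  effect.\<close>

lemma mult_Gal_complex_real:
  assumes "\<sigma> \<in> carrier Gal_complex_real" "\<tau> \<in> carrier Gal_complex_real"
  shows "\<sigma> \<otimes>\<^bsub>Gal_complex_real\<^esub> \<tau> = \<sigma> \<circ> \<tau>"
proof -
  have "\<sigma> \<in> Bij UNIV" "\<tau> \<in> Bij UNIV"
    using assms by (auto simp: galois_group_def)
  thus ?thesis by (simp add: galois_group_def BijGroup_def compose_def fun_eq_iff)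
qed

lemma cnj_neq_id: "cnj \<noteq> id"
proof
  assume "cnj = id"
  hence "cnj \<i> = \<i>" by simp
  thus False by simp
qed

lemma group_Gal_complex_real: "group Gal_complex_real"
proof (rule groupI)
  have one: "\<one>\<^bsub>Gal_complex_real\<^esub> = id"
    by (simp add: galois_group_def BijGroup_def fun_eq_iff)
  show "\<one>\<^bsub>Gal_complex_real\<^esub> \<in> carrier Gal_complex_real"
    by (simp add: one carrier_Gal_complex_real)
  fix x y z assume x: "x \<in> carrier Gal_complex_real"
  show "\<one>\<^bsub>Gal_complex_real\<^esub> \<otimes>\<^bsub>Gal_complex_real\<^esub> x = x"
    using x by (simp add: mult_Gal_complex_real one carrier_Gal_complex_real)
  show "\<exists>y\<in>carrier Gal_complex_real. y \<otimes>\<^bsub>Gal_complex_real\<^esub> x = \<one>\<^bsub>Gal_complex_real\<^esub>"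
    \<comment> \<open>Identity and conjugation are involutions, so \<open>x\<close> is its own left
      inverse.\<close>
    using x by (intro bexI[of _ x]) (auto simp: mult_Gal_complex_real one carrier_Gal_complex_real)
  assume y: "y \<in> carrier Gal_complex_real"
  show xy: "x \<otimes>\<^bsub>Gal_complex_real\<^esub> y \<in> carrier Gal_complex_real"
    unfolding mult_Gal_complex_real[OF x y] using x y by (auto simp: carrier_Gal_complex_real fun_eq_iff)
  assume z: "z \<in> carrier Gal_complex_real"
  have yz: "y \<otimes>\<^bsub>Gal_complex_real\<^esub> z \<in> carrier Gal_complex_real"
    unfolding mult_Gal_complex_real[OF y z] using y z by (auto simp: carrier_Gal_complex_real fun_eq_iff)
  show "x \<otimes>\<^bsub>Gal_complex_real\<^esub> y \<otimes>\<^bsub>Gal_complex_real\<^esub> z = x \<otimes>\<^bsub>Gal_complex_real\<^esub> (y \<otimes>\<^bsub>Gal_complex_real\<^esub> z)"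
    using mult_Gal_complex_real[OF xy z] mult_Gal_complex_real[OF x yz]
      mult_Gal_complex_real[OF x y] mult_Gal_complex_real[OF y z] by (simp add: comp_assoc)
qed

lemma Gal_complex_real_iso: "Gal_complex_real \<cong> integer_mod_group 2"
proof -
  let ?h = "\<lambda>\<sigma> :: complex \<Rightarrow> complex. if \<sigma> = id then 0 else 1 :: int"
  have "?h \<in> iso Gal_complex_real (integer_mod_group 2)"
    unfolding iso_def hom_def bij_betw_def
    using cnj_neq_id
    by (auto simp: carrier_Gal_complex_real carrier_integer_mod_group mult_Gal_complex_real inj_on_def fun_eq_iff)
  thus ?thesis by (auto simp: is_iso_def)
qed

theorem theorem3p12:
  fixes C :: "('o, 'm, real) monoidal_cat"
  assumes "fusion_category (class_ring :: real ring) C"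
    and "\<exists>X \<in> Obj C. galois_nontrivial C X"
  shows "Gal_complex_real \<cong> integer_mod_group 2 \<and>
    (\<exists>D. is_faithful_grading (class_ring :: real ring) C Gal_complex_real D)"
proof
  show "Gal_complex_real \<cong> integer_mod_group 2" by (rule Gal_complex_real_iso)
  interpret real_fusion_category C using assms(1) by (simp add: real_fusion_category_def)
  obtain X where X: "X \<in> Obj C" "galois_nontrivial C X" using assms(2) by blast
  obtain J where J: "J \<in> unit_End" "J \<cdot>\<^bsub>C\<^esub> J = ScaleA C (-1) (Id C (UnitO C))"
    and ne: "left_embedding C X J \<noteq> right_embedding C X J"
    using ex_imaginary_unit[OF X] by metis
  \<comment> \<open>The number Im (\<sigma> i) is the sign by which \<sigma> acts on i: 1 for the
    identity and -1 for conjugation.\<close>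
  define D where "D = (\<lambda>\<sigma> :: complex \<Rightarrow> complex. eigen_objects J (Im (\<sigma> \<i>)))"
  have D: "D id = eigen_objects J 1" "D cnj = eigen_objects J (-1)" by (simp_all add: D_def)
  let ?G = "{id, cnj}"
  have "decomposes_as_direct_sum C ?G D"
  proof (rule decomposes_as_direct_sumI)
    show "\<exists>Xs \<iota> \<pi>. (\<forall>i\<in>?G. Xs i \<in> D i) \<and> is_direct_sum C ?G Xs X \<iota> \<pi>" if X: "X \<in> Obj C" for X
      using decomposition[OF J X cnj_neq_id[symmetric]] by (auto simp: D)
    show "f = ZeroA C X Y"
      if "i \<in> ?G" "j \<in> ?G" "i \<noteq> j" "X \<in> D i" "Y \<in> D j" "f \<in> Hom C X Y" for i j X Y f
      using that by (intro eigen_objects_orthogonal[OF J, of X "Im (i \<i>)" Y "Im (j \<i>)"]) (auto simp: D_def)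
  qed
  moreover have "full_abelian_subcategory class_ring C (D \<sigma>)" for \<sigma>
    using closed_subcategory.full_abelian_subcategory[OF closed_subcategory_eigen_objects[OF J]] by (simp add: D_def)
  moreover have "X \<boxdot>\<^bsub>C\<^esub> Y \<in> D (\<sigma> \<circ> \<tau>)" if "\<sigma> \<in> ?G" "\<tau> \<in> ?G" "X \<in> D \<sigma>" "Y \<in> D \<tau>" for \<sigma> \<tau> X Y
  proof -
    \<comment> \<open>Signs multiply under composition because both maps send i to i or to
      -i.\<close>
    have "Im ((\<sigma> \<circ> \<tau>) \<i>) = Im (\<sigma> \<i>) * Im (\<tau> \<i>)" using that by auto
    thus ?thesis using eigen_objects_Ten[OF J] that(3,4) by (simp add: D_def)
  qed
  ultimately have "is_grading class_ring C Gal_complex_real D"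
    using group_Gal_complex_real
    by (simp add: is_grading_def carrier_Gal_complex_real mult_Gal_complex_real)
  moreover have "\<forall>\<sigma>\<in>?G. \<exists>X\<in>D \<sigma>. \<not> zero_object C X"
    using unit_in_eigen_objects[OF J] unit_not_zero ex_nonzero_minus[OF J X(1) ne] by (auto simp: D)
  ultimately show "\<exists>D. is_faithful_grading class_ring C Gal_complex_real D"
    unfolding is_faithful_grading_def carrier_Gal_complex_real by blast
qed

end
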